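(* Let $$G(t_1)=\eta(q)\,\mathrm{tr}|_{\mathcal{F}_0}\,X(\psi,t_1x_1)X(\psi^*,x_1)q^{\bar L(0)}.$$ Then, as formal series, $$G(qt_1)+q^{1/2}t_1\,G(t_1)=\delta_{1/2}(qt_1).$$
   Context: Charged free fermions: the Lie superalgebra with odd generators $\psi(n),\psi^*(n)$, $n\in\mathbb{Z}+\frac12$, and central $1$, with $[\psi(n),\psi^*(m)]=\delta_{m+n,0}$, $[\psi(n),\psi(m)]=[\psi^*(n),\psi^*(m)]=0$ (anticommutators). $\mathcal{F}$ is the Fock space generated from $\mathbf 1$ with $\psi(n)\mathbf 1=\psi^*(n)\mathbf 1=0$ for $n>0$, a vertex operator superalgebra of central charge $1$ with conformal vector $\omega=\frac12\psi^*(-3/2)\psi(-1/2)\mathbf 1+\frac12\psi(-3/2)\psi^*(-1/2)\mathbf 1$; $\mathcal{F}=\bigoplus_m\mathcal{F}_m$ is the charge decomposition ($\psi(n),\psi^*(n)$ have charges $1,-1$, $\mathbf 1$ has charge $0$). With $\psi=\psi(-1/2)\mathbf 1$, $\psi^*=\psi^*(-1/2)\mathbf 1$: $X(\psi,tx)=\sum_{n\in\mathbb{Z}+1/2}\psi(n)t^{-n}x^{-n}$, $X(\psi^*,x)=\sum_{n\in\mathbb{Z}+1/2}\psi^*(n)x^{-n}$ (the trace $G(t_1)$ does not depend on $x_1$). $\bar L(0)=L(0)-\frac1{24}$, $\eta(q)=q^{1/24}\prod_{n\ge1}(1-q^n)$, $\delta_{1/2}(t)=\sum_{n\in\mathbb{Z}+1/2}t^n$.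 The variables are formal; $G(t_1)$ is a series in half-odd-integral powers of $t_1$ with coefficients power series in $q$, and $G(qt_1)$ is obtained by substituting $qt_1$ for $t_1$. *)

theory Defs
  imports
    "HOL-Analysis.Analysis"
    "HOL-Computational_Algebra.Formal_Laurent_Series"
    "HOL-Library.Groups_Big_Fun"
begin

section \<open>Formal series\<close>

definition half_odd :: "rat set" where
  "half_odd = range (\<lambda>k::int. of_int k + 1/2)"

text \<open>
  Series in \<open>q\<close> with exponents in \<open>(1/24)\<int>\<close> (bounded below) are formal Laurent series whose
  variable stands for \<open>q\<^sup>1\<^sup>/\<^sup>2\<^sup>4\<close>.  Thus \<open>qpow r\<close> is \<open>q\<close> to the power \<open>r\<close>, for \<open>24 r\<close> an integer
  (the only exponents that are used).
\<close>

type_synonym qseries = "complex fls"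

definition qpow :: "rat \<Rightarrow> qseries" where
  "qpow r = fls_X_intpow \<lfloor>24 * r\<rfloor>"

text \<open>The infinite product is a limit in the topology of the ring of formal power series.\<close>

definition eta :: qseries where
  "eta = qpow (1/24) * fps_to_fls (prodinf (\<lambda>n. 1 - fps_X ^ (24 * Suc n)))"

text \<open>
  A formal series in \<open>t\<close> and \<open>x\<close>, infinite in all directions and with rational exponents, is the
  function sending \<open>a\<close>, \<open>b\<close> to the coefficient of the monomial with exponent \<open>a\<close> of \<open>t\<close> and
  exponent \<open>b\<close> of \<open>x\<close>.
\<close>

type_synonym 'c tx_series = "rat \<Rightarrow> rat \<Rightarrow> 'c"

definition delta_half :: "qseries tx_series" where
  "delta_half a b = (if a \<in> half_odd \<and> b = 0 then 1 else 0)"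

text \<open>The substitution of \<open>q t\<close> for \<open>t\<close>.\<close>

definition subst_qt :: "qseries tx_series \<Rightarrow> qseries tx_series" where
  "subst_qt F a b = qpow a * F a b"

definition times_t :: "qseries tx_series \<Rightarrow> qseries tx_series" where
  "times_t F a b = F (a - 1) b"

text \<open>
  Substituting \<open>x\<close>, respectively \<open>t x\<close>, for the variable of a one-variable series with operator
  coefficients.
\<close>

definition at_x :: "(rat \<Rightarrow> 'v \<Rightarrow> 'v::zero) \<Rightarrow> ('v \<Rightarrow> 'v) tx_series" where
  "at_x A a b = (if a = 0 then A b else (\<lambda>_. 0))"

definition at_tx :: "(rat \<Rightarrow> 'v \<Rightarrow> 'v::zero) \<Rightarrow> ('v \<Rightarrow> 'v) tx_series" where
  "at_tx A a b = (if a = b then A a else (\<lambda>_. 0))"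

text \<open>
  Product of series with operator coefficients.  \<open>Sum_any\<close> sums the nonzero terms; it would be
  \<open>0\<close> if there were infinitely many of them, but in a product of an \<open>at_tx\<close> by an \<open>at_x\<close> there is
  at most one.
\<close>

definition op_mult ::
  "('v \<Rightarrow> 'v::comm_monoid_add) tx_series \<Rightarrow> ('v \<Rightarrow> 'v) tx_series \<Rightarrow> ('v \<Rightarrow> 'v) tx_series" where
  "op_mult A B a b v = Sum_any (\<lambda>(c, d). A c d (B (a - c) (b - d) v))"


section \<open>The Fock space of charged free fermions\<close>

text \<open>
  Words in the generators applied to the vacuum, with their charge.
\<close>

inductive fermion_word ::
  "(rat \<Rightarrow> 'v \<Rightarrow> 'v) \<Rightarrow> (rat \<Rightarrow> 'v \<Rightarrow> 'v) \<Rightarrow> 'v \<Rightarrow> int \<Rightarrow> 'v \<Rightarrow> bool"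
  for \<psi> \<psi>s vac where
  vac: "fermion_word \<psi> \<psi>s vac 0 vac"
| psi: "n \<in> half_odd \<Longrightarrow> fermion_word \<psi> \<psi>s vac m v \<Longrightarrow> fermion_word \<psi> \<psi>s vac (m + 1) (\<psi> n v)"
| psis: "n \<in> half_odd \<Longrightarrow> fermion_word \<psi> \<psi>s vac m v \<Longrightarrow> fermion_word \<psi> \<psi>s vac (m - 1) (\<psi>s n v)"

text \<open>
  The Fock space is the whole type \<open>'v\<close>, a complex vector space with scalar multiplication
  \<open>scale\<close>.  The axioms determine it up to isomorphism; the central element acts as the identity.
  The values of \<open>\<psi> n\<close> and \<open>\<psi>s n\<close> for \<open>n\<close> outside \<open>\<int> + 1/2\<close> are irrelevant.
\<close>

locale charged_free_fermions = vector_space scale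
  for scale :: "complex \<Rightarrow> 'v::ab_group_add \<Rightarrow> 'v" +
  fixes \<psi> \<psi>s :: "rat \<Rightarrow> 'v \<Rightarrow> 'v" and vac :: 'v
  assumes psi_linear: "n \<in> half_odd \<Longrightarrow> Vector_Spaces.linear scale scale (\<psi> n)"
    and psis_linear: "n \<in> half_odd \<Longrightarrow> Vector_Spaces.linear scale scale (\<psi>s n)"
    and anticomm_psi_psis: "n \<in> half_odd \<Longrightarrow> m \<in> half_odd \<Longrightarrow>
          \<psi> n (\<psi>s m v) + \<psi>s m (\<psi> n v) = (if m + n = 0 then v else 0)"
    and anticomm_psi: "n \<in> half_odd \<Longrightarrow> m \<in> half_odd \<Longrightarrow> \<psi> n (\<psi> m v) + \<psi> m (\<psi> n v) = 0"
    and anticomm_psis: "n \<in> half_odd \<Longrightarrow> m \<in> half_odd \<Longrightarrow> \<psi>s n (\<psi>s m v) + \<psi>s m (\<psi>s n v) = 0"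
    and psi_vac: "n \<in> half_odd \<Longrightarrow> n > 0 \<Longrightarrow> \<psi> n vac = 0"
    and psis_vac: "n \<in> half_odd \<Longrightarrow> n > 0 \<Longrightarrow> \<psi>s n vac = 0"
    and vac_nonzero: "vac \<noteq> 0"
    and generated: "span {v. \<exists>m. fermion_word \<psi> \<psi>s vac m v} = UNIV"
begin

definition charge_space :: "int \<Rightarrow> 'v set" where
  "charge_space m = span {v. fermion_word \<psi> \<psi>s vac m v}"

subsection \<open>The conformal vector\<close>

text \<open>
  A field is given by its coefficients: \<open>A k\<close> is the coefficient of the \<open>k\<close>-th power of \<open>x\<close>.
  The vertex operators of \<open>\<psi>(-1/2)1\<close> and \<open>\<psi>s(-1/2)1\<close> are the sums of \<open>\<psi>(n)\<close> and \<open>\<psi>s(n)\<close> times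
  the power \<open>-n-1/2\<close> of \<open>x\<close>.
\<close>

definition Y_psi :: "int \<Rightarrow> 'v \<Rightarrow> 'v" where
  "Y_psi k = \<psi> (- of_int k - 1/2)"

definition Y_psis :: "int \<Rightarrow> 'v \<Rightarrow> 'v" where
  "Y_psis k = \<psi>s (- of_int k - 1/2)"

definition field_deriv :: "(int \<Rightarrow> 'v \<Rightarrow> 'v) \<Rightarrow> int \<Rightarrow> 'v \<Rightarrow> 'v" where
  "field_deriv A k v = scale (of_int (k + 1)) (A (k + 1) v)"

text \<open>
  Normally ordered product of two odd fields, \<open>A\<^sub>+ B - B A\<^sub>-\<close>, where \<open>A\<^sub>+\<close> consists of the
  terms of \<open>A\<close> with nonnegative powers of \<open>x\<close> and \<open>A\<^sub>-\<close> of the others.  On a given vector only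
  finitely many terms are nonzero.
\<close>

definition normal_prod :: "(int \<Rightarrow> 'v \<Rightarrow> 'v) \<Rightarrow> (int \<Rightarrow> 'v \<Rightarrow> 'v) \<Rightarrow> int \<Rightarrow> 'v \<Rightarrow> 'v" where
  "normal_prod A B k v =
     Sum_any (\<lambda>i. if i \<ge> 0 then A i (B (k - i) v) else - B (k - i) (A i v))"

text \<open>
  The vertex operator of \<open>\<omega> = 1/2 \<psi>s(-3/2)\<psi>(-1/2)1 + 1/2 \<psi>(-3/2)\<psi>s(-1/2)1\<close>: for fermions
  \<open>a\<close>, \<open>b\<close> the state \<open>a(-3/2)b(-1/2)1\<close> has as vertex operator the normally ordered product of the
  derivative of \<open>Y(a,x)\<close> with \<open>Y(b,x)\<close>.
\<close>

definition Y_omega :: "int \<Rightarrow> 'v \<Rightarrow> 'v" where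
  "Y_omega k v = scale (1/2) (normal_prod (field_deriv Y_psis) Y_psi k v)
               + scale (1/2) (normal_prod (field_deriv Y_psi) Y_psis k v)"

text \<open>\<open>L(n)\<close> is the coefficient of the power \<open>-n-2\<close> of \<open>x\<close> in \<open>Y(\<omega>,x)\<close>.\<close>

definition L :: "int \<Rightarrow> 'v \<Rightarrow> 'v" where
  "L n = Y_omega (- n - 2)"

definition Lbar0 :: "'v \<Rightarrow> 'v" where
  "Lbar0 v = L 0 v - scale (1/24) v"

subsection \<open>Traces\<close>

definition eigenbasis :: "'v set \<Rightarrow> ('v \<Rightarrow> 'v) \<Rightarrow> 'v set \<Rightarrow> bool" where
  "eigenbasis W D B \<longleftrightarrow> independent B \<and> span B = W \<and> (\<forall>b\<in>B. \<exists>c. D b = scale c b)"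

text \<open>
  The trace over \<open>W\<close> of \<open>T q\<^sup>D\<close>, for \<open>T\<close> preserving \<open>W\<close> and \<open>D\<close> diagonalisable on \<open>W\<close> with
  finite-dimensional eigenspaces and with eigenvalues in \<open>(1/24)\<int>\<close> that are bounded below: the
  sum, over the vectors \<open>b\<close> of a basis of eigenvectors of \<open>D\<close>, of the diagonal matrix coefficients
  of \<open>T q\<^sup>D\<close>.  It does not depend on the basis.  The coefficient with index \<open>k\<close> belongs
  to the power \<open>k/24\<close> of \<open>q\<close>.  The operator \<open>T\<close> need not commute with \<open>D\<close>.
\<close>

definition trace_q :: "'v set \<Rightarrow> ('v \<Rightarrow> 'v) \<Rightarrow> ('v \<Rightarrow> 'v) \<Rightarrow> qseries" where
  "trace_q W T D =
     (let B = SOME B. eigenbasis W D B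
      in Abs_fls (\<lambda>k. \<Sum>b\<in>{b\<in>B. D b = scale (of_int k / 24) b}. representation B (T b) b))"

definition X_psi :: "rat \<Rightarrow> 'v \<Rightarrow> 'v" where
  "X_psi r = (if r \<in> half_odd then \<psi> (- r) else (\<lambda>_. 0))"

definition X_psis :: "rat \<Rightarrow> 'v \<Rightarrow> 'v" where
  "X_psis r = (if r \<in> half_odd then \<psi>s (- r) else (\<lambda>_. 0))"

text \<open>The trace is taken coefficientwise in \<open>t\<close> and \<open>x\<close>.\<close>

definition G :: "qseries tx_series" where
  "G a b = eta * trace_q (charge_space 0) (op_mult (at_tx X_psi) (at_x X_psis) a b) Lbar0"

end

end

theory Submission
  imports Defs
begin

text \<open>
The coefficient of \<open>t\<^sup>a\<close> in \<open>G(t)\<close>, for \<open>a = k + 1/2\<close>, is \<open>\<eta>(q)\<close> times the trace of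
\<open>\<psi>(-a) \<psi>*(a) q\<^bsup>L(0)-1/24\<^esup>\<close> over the neutral subspace.  In the picture of Maya diagrams the vacuum is
a sea in which the levels \<open>k < 0\<close> are occupied and the levels \<open>k \<ge> 0\<close> are empty; \<open>\<psi>(-k-1/2)\<close>
fills the level \<open>k\<close> and \<open>\<psi>*(k+1/2)\<close> vacates it.  The vectors obtained by changing finitely many
levels form a basis of the Fock space, consisting of eigenvectors of \<open>L(0)\<close>, and \<open>\<psi>(-a) \<psi>*(a)\<close> is the
projection onto those in which the level \<open>k\<close> is occupied (lemma \<open>fill_vacate\<close>).  So the trace is
the generating function \<open>N\<^sub>k\<close>, by energy minus \<open>1/24\<close>, of the neutral diagrams with occupied
level \<open>k\<close>.  The coefficients with a nonzero power of \<open>x\<close> vanish, because there the operator moves a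
fermion to another level (lemma \<open>trace_hop_eq_0\<close>).

Take a neutral diagram in which the level \<open>k\<close> is empty.  Filling that level, which costs the
energy \<open>k + 1/2\<close>, and then lowering the whole diagram by one level, which restores charge \<open>0\<close> and
changes the energy by \<open>-1/2\<close>, gives a neutral diagram in which the level \<open>k - 1\<close> is occupied, and
this is a bijection (lemma \<open>card_neutral_level_unoccupied\<close>).  If \<open>Z\<close> denotes the same generating
function for all neutral diagrams, then \<open>N\<^sub>k + q\<^bsup>-k\<^esup> N\<^bsub>k-1\<^esub> = Z\<close> (lemma \<open>trace_recursion\<close>).
Multiplied by \<open>\<eta>(q) q\<^bsup>k+1/2\<^esup>\<close> this is the claim, once \<open>\<eta>(q) Z = 1\<close> is known.

The identity \<open>\<eta>(q) Z = 1\<close> (lemma \<open>eta_neutral_gf\<close>) says that \<open>1/\<Prod>(1 - q\<^sup>n)\<close> counts the neutral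
diagrams.  Diagrams that differ from the vacuum only in the levels from \<open>-N\<close> to \<open>N - 1\<close> correspond
to the \<open>N\<close>-element subsets of a set with \<open>2 N\<close> elements, and these are counted by a Gaussian
binomial coefficient, whose limit is the inverse of the product.

The trace is defined through an arbitrarily chosen basis of eigenvectors of \<open>L(0)\<close>, whereas the
computation uses the basis of Maya diagrams; lemma \<open>trace_on_eigenspace_indep\<close> bridges the two.
All series in \<open>q\<close> are series in \<open>y = q\<^bsup>1/24\<^esup>\<close>.
\<close>

section \<open>Maya diagrams\<close>

text \<open>
A Maya diagram is encoded by the finite set \<open>S\<close> of the levels at which it differs from the vacuum:
the filled levels \<open>k \<ge> 0\<close> and the emptied levels \<open>k < 0\<close>.
\<close>

definition occupied :: "int set \<Rightarrow> int \<Rightarrow> bool" where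
  "occupied S k \<longleftrightarrow> (k \<in> S \<longleftrightarrow> 0 \<le> k)"

definition toggle :: "int set \<Rightarrow> int \<Rightarrow> int set" where
  "toggle S k = (if k \<in> S then S - {k} else insert k S)"

definition charge :: "int set \<Rightarrow> int" where
  "charge S = (\<Sum>k\<in>S. if 0 \<le> k then 1 else -1)"

text \<open>
Twice the energy, to stay within the integers: a change at level \<open>k\<close> has energy \<open>\<bar>k + 1/2\<bar>\<close>.
\<close>

definition energy2 :: "int set \<Rightarrow> int" where
  "energy2 S = (\<Sum>k\<in>S. \<bar>2 * k + 1\<bar>)"

lemma in_toggle: "j \<in> toggle S k \<longleftrightarrow> (if j = k then k \<notin> S else j \<in> S)"
  by (auto simp: toggle_def)

lemma finite_toggle [simp]: "finite (toggle S k) \<longleftrightarrow> finite S"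
  by (simp add: toggle_def)

lemma toggle_toggle [simp]: "toggle (toggle S k) k = S"
  by (auto simp: toggle_def)

lemma occupied_toggle: "occupied (toggle S k) j \<longleftrightarrow> (if j = k then \<not> occupied S j else occupied S j)"
  by (auto simp: occupied_def in_toggle)

text \<open>
The encoding by differences from the vacuum disappears from the effect of a toggle: filling a
level costs \<open>k + 1/2\<close> and adds a charge whichever the sign of \<open>k\<close>.
\<close>

lemma charge_toggle:
  assumes "finite S"
  shows "charge (toggle S k) = charge S + (if occupied S k then -1 else 1)"
  using assms by (auto simp: charge_def toggle_def occupied_def sum_diff1)

lemma energy2_toggle:
  assumes "finite S"
  shows "energy2 (toggle S k) = energy2 S + (if occupied S k then -(2 * k + 1) else 2 * k + 1)"
  using assms by (auto simp: energy2_def toggle_def occupied_def sum_diff1)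

text \<open>
Moves every fermion of the diagram down by one level.  The sea moves along, so that its top level
\<open>-1\<close> becomes empty; relative to the vacuum this is one more toggle.
\<close>

definition lower :: "int set \<Rightarrow> int set" where
  "lower S = toggle ((\<lambda>k. k - 1) ` S) (-1)"

lemma in_lower: "k \<in> lower S \<longleftrightarrow> (if k = -1 then 0 \<notin> S else k + 1 \<in> S)"
  by (force simp: lower_def in_toggle image_iff)

lemma finite_lower [simp]: "finite (lower S) \<longleftrightarrow> finite S"
  by (auto simp: lower_def finite_image_iff inj_on_def)

lemma occupied_lower: "occupied (lower S) k \<longleftrightarrow> occupied S (k + 1)"
  by (auto simp: occupied_def in_lower)

lemma occupied_image_pred: "occupied ((\<lambda>k. k - 1) ` S) (-1) \<longleftrightarrow> 0 \<notin> S"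
  by (force simp: occupied_def image_iff)

lemma charge_lower:
  assumes "finite S"
  shows "charge (lower S) = charge S - 1"
proof -
  have "charge ((\<lambda>k. k - 1) ` S) = (\<Sum>k\<in>S. if 1 \<le> k then 1 else -1)"
    unfolding charge_def by (subst sum.reindex) (auto simp: inj_on_def intro!: sum.cong)
  also have "\<dots> = (\<Sum>k\<in>S. (if 0 \<le> k then 1 else -1) - (if k = 0 then 2 else 0))"
    by (intro sum.cong) auto
  also have "\<dots> = charge S - (if 0 \<in> S then 2 else 0)"
    using assms by (simp add: sum_subtractf charge_def)
  finally show ?thesis
    using assms by (simp add: lower_def charge_toggle occupied_image_pred)
qed

text \<open>
Each unit of charge carries the energy \<open>1\<close> less; the constant is the energy of the hole that the
lowered sea leaves at level \<open>-1\<close>.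
\<close>

lemma energy2_lower:
  assumes "finite S"
  shows "energy2 (lower S) = energy2 S - 2 * charge S + 1"
proof -
  have "energy2 ((\<lambda>k. k - 1) ` S) = (\<Sum>k\<in>S. \<bar>2 * k - 1\<bar>)"
    unfolding energy2_def by (subst sum.reindex) (auto simp: inj_on_def intro!: sum.cong)
  also have "\<dots> = (\<Sum>k\<in>S. \<bar>2 * k + 1\<bar> - 2 * (if 0 \<le> k then 1 else -1) + (if k = 0 then 2 else 0))"
    by (intro sum.cong) auto
  also have "\<dots> = energy2 S - 2 * charge S + (if 0 \<in> S then 2 else 0)"
    using assms by (simp add: sum_subtractf sum.distrib charge_def energy2_def sum_distrib_left)
  finally show ?thesis
    using assms by (simp add: lower_def energy2_toggle occupied_image_pred)
qed

definition lift :: "int set \<Rightarrow> int set" where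
  "lift S = (\<lambda>k. k + 1) ` toggle S (-1)"

lemma in_lift: "k \<in> lift S \<longleftrightarrow> (if k = 0 then -1 \<notin> S else k - 1 \<in> S)"
  by (force simp: lift_def in_toggle image_iff)

lemma lower_lift [simp]: "lower (lift S) = S"
  by (auto simp: set_eq_iff in_lower in_lift)

lemma lift_lower [simp]: "lift (lower S) = S"
  by (auto simp: set_eq_iff in_lower in_lift)

lemma finite_lift [simp]: "finite (lift S) \<longleftrightarrow> finite S"
  using finite_lower[of "lift S"] by simp

text \<open>
The neutral diagrams whose contribution to a trace of \<open>q\<^bsup>L(0)-1/24\<^esup>\<close> has the exponent \<open>j/24\<close>.
\<close>

definition neutral_level :: "int \<Rightarrow> int set set" where
  "neutral_level j = {S. finite S \<and> charge S = 0 \<and> 12 * energy2 S - 1 = j}"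

lemma energy2_nonneg: "energy2 S \<ge> 0"
  by (auto simp: energy2_def intro: sum_nonneg)

lemma abs_le_energy2:
  assumes "finite S" "k \<in> S"
  shows "\<bar>2 * k + 1\<bar> \<le> energy2 S"
  unfolding energy2_def using assms by (intro member_le_sum) auto

lemma finite_neutral_level: "finite (neutral_level j)"
proof (rule finite_subset)
  show "neutral_level j \<subseteq> Pow {- j - 1..j + 1}"
  proof (intro subsetI PowI)
    fix S k assume S: "S \<in> neutral_level j" and "k \<in> S"
    then have "\<bar>2 * k + 1\<bar> \<le> energy2 S"
      by (intro abs_le_energy2) (auto simp: neutral_level_def)
    then show "k \<in> {- j - 1..j + 1}"
      using S energy2_nonneg[of S] by (auto simp: neutral_level_def)
  qed
qed simp

lemma neutral_level_neg: "j < -1 \<Longrightarrow> neutral_level j = {}"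
proof -
  assume "j < -1"
  then have "S \<notin> neutral_level j" for S
    using energy2_nonneg[of S] by (simp add: neutral_level_def)
  then show ?thesis by blast
qed

text \<open>
The combinatorial heart of the functional equation.  Filling level \<open>k\<close> gives charge \<open>1\<close> and lowering
brings it back to \<open>0\<close>, while the occupied level \<open>k\<close> becomes level \<open>k - 1\<close>; twice the energy grows
by \<open>(2 k + 1) - 2 + 1 = 2 k\<close>.
\<close>

lemma card_neutral_level_unoccupied:
  "card {S \<in> neutral_level j. \<not> occupied S k} = card {S \<in> neutral_level (j + 24 * k). occupied S (k - 1)}"
proof (rule bij_betw_same_card)
  show "bij_betw (\<lambda>S. lower (toggle S k)) {S \<in> neutral_level j. \<not> occupied S k}
          {S \<in> neutral_level (j + 24 * k). occupied S (k - 1)}"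
  proof (rule bij_betw_byWitness[where f' = "\<lambda>S. toggle (lift S) k"])
    show "(\<lambda>S. lower (toggle S k)) ` {S \<in> neutral_level j. \<not> occupied S k}
            \<subseteq> {S \<in> neutral_level (j + 24 * k). occupied S (k - 1)}"
      by (auto simp: neutral_level_def charge_lower energy2_lower charge_toggle energy2_toggle
          occupied_lower occupied_toggle)
    have "toggle (lift S) k \<in> neutral_level j \<and> \<not> occupied (toggle (lift S) k) k"
      if S: "S \<in> neutral_level (j + 24 * k)" "occupied S (k - 1)" for S
    proof -
      have fin: "finite (lift S)" using S by (simp add: neutral_level_def)
      have "charge (lift S) = 1" "12 * energy2 (lift S) = j + 24 * k + 13"
        using charge_lower[OF fin] energy2_lower[OF fin] S by (auto simp: neutral_level_def)
      moreover have "occupied (lift S) k"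
        using occupied_lower[of "lift S" "k - 1"] S by simp
      ultimately show ?thesis
        using fin by (auto simp: neutral_level_def charge_toggle energy2_toggle occupied_toggle)
    qed
    then show "(\<lambda>S. toggle (lift S) k) ` {S \<in> neutral_level (j + 24 * k). occupied S (k - 1)}
                 \<subseteq> {S \<in> neutral_level j. \<not> occupied S k}"
      by auto
  qed auto
qed

section \<open>Counting the neutral diagrams\<close>

text \<open>
The \<open>q\<close>-Pochhammer symbol \<open>(q; q)\<^sub>n\<close>.
\<close>

definition qfact :: "'a::comm_ring_1 \<Rightarrow> nat \<Rightarrow> 'a" where
  "qfact q n = (\<Prod>i<n. 1 - q ^ Suc i)"

text \<open>
This is the Gaussian binomial coefficient of \<open>n\<close> over \<open>k\<close> times \<open>q\<^bsup>k(k-1)/2\<^esup>\<close>, the term of the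
smallest subset \<open>{0, ..., k - 1}\<close>.
\<close>

definition subset_gf :: "'a::comm_ring_1 \<Rightarrow> nat \<Rightarrow> nat \<Rightarrow> 'a" where
  "subset_gf q n k = (\<Sum>A | A \<subseteq> {..<n} \<and> card A = k. q ^ \<Sum>A)"

lemma subset_gf_0: "subset_gf q n 0 = 1"
proof -
  have "{A. A \<subseteq> {..<n} \<and> card A = 0} = {{}}"
    by (auto dest: finite_subset)
  then show ?thesis by (simp add: subset_gf_def)
qed

lemma subset_gf_gt: "n < k \<Longrightarrow> subset_gf q n k = 0"
proof -
  assume "n < k"
  have "card A \<le> n" if "A \<subseteq> {..<n}" for A
    using card_mono[OF _ that] by simp
  with \<open>n < k\<close> have "{A. A \<subseteq> {..<n} \<and> card A = k} = {}"
    using leD by blast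
  then show ?thesis unfolding subset_gf_def by (simp only: sum.empty)
qed

text \<open>
The \<open>q\<close>-Pascal rule: a subset either contains the last element \<open>n\<close> or does not.
\<close>

lemma subset_gf_Suc:
  "subset_gf q (Suc n) (Suc k) = subset_gf q n (Suc k) + q ^ n * subset_gf q n k"
proof -
  let ?F = "\<lambda>(n::nat) k. {A. A \<subseteq> {..<n} \<and> card A = k}"
  have fin: "finite A" if "A \<subseteq> {..<n}" for A and n :: nat
    using that by (rule finite_subset) simp
  have finF: "finite (?F n k)" for n k
    by (rule finite_subset[of _ "Pow {..<n}"]) auto
  have split: "?F (Suc n) (Suc k) = ?F n (Suc k) \<union> insert n ` ?F n k"
  proof (intro equalityI subsetI)
    fix A assume A: "A \<in> ?F (Suc n) (Suc k)"
    show "A \<in> ?F n (Suc k) \<union> insert n ` ?F n k"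
    proof (cases "n \<in> A")
      case True
      then have "A = insert n (A - {n})" "A - {n} \<in> ?F n k"
        using A fin[of A "Suc n"] by (auto simp: less_Suc_eq)
      then show ?thesis by blast
    next
      case False
      then show ?thesis using A by (fastforce simp: less_Suc_eq)
    qed
  next
    fix A assume "A \<in> ?F n (Suc k) \<union> insert n ` ?F n k"
    then show "A \<in> ?F (Suc n) (Suc k)"
    proof
      assume "A \<in> insert n ` ?F n k"
      then obtain B where "B \<subseteq> {..<n}" "card B = k" "A = insert n B" by auto
      moreover from this have "n \<notin> B" "finite B" using fin by auto
      ultimately show ?thesis by (auto simp: less_Suc_eq)
    qed (auto simp: less_Suc_eq)
  qed
  have disj: "?F n (Suc k) \<inter> insert n ` ?F n k = {}" by auto
  have inj: "inj_on (insert n) (?F n k)"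
  proof (rule inj_onI)
    fix A B assume AB: "A \<in> ?F n k" "B \<in> ?F n k" "insert n A = insert n B"
    then have "n \<notin> A" "n \<notin> B" by auto
    with AB(3) show "A = B" by (simp add: insert_ident)
  qed
  have summand: "(\<Sum>A\<in>?F n k. q ^ \<Sum>(insert n A)) = (\<Sum>A\<in>?F n k. q ^ n * q ^ \<Sum>A)"
  proof (rule sum.cong)
    fix A assume "A \<in> ?F n k"
    then have "finite A" "n \<notin> A" using fin by auto
    then show "q ^ \<Sum>(insert n A) = q ^ n * q ^ \<Sum>A" by (simp add: power_add)
  qed simp
  have "(\<Sum>A\<in>?F (Suc n) (Suc k). q ^ \<Sum>A)
      = (\<Sum>A\<in>?F n (Suc k). q ^ \<Sum>A) + (\<Sum>A\<in>insert n ` ?F n k. q ^ \<Sum>A)"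
    unfolding split by (rule sum.union_disjoint) (use finF disj in auto)
  also have "(\<Sum>A\<in>insert n ` ?F n k. q ^ \<Sum>A) = q ^ n * (\<Sum>A\<in>?F n k. q ^ \<Sum>A)"
    unfolding sum.reindex[OF inj] o_def summand sum_distrib_left ..
  finally show ?thesis unfolding subset_gf_def .
qed

text \<open>
The product formula for Gaussian binomial coefficients, free of denominators so that it holds in
every commutative ring.
\<close>

lemma subset_gf_gaussian:
  "k \<le> n \<Longrightarrow> subset_gf q n k * qfact q k * qfact q (n - k) = q ^ (k choose 2) * qfact q n"
proof (induction n arbitrary: k)
  case 0
  then show ?case by (simp add: subset_gf_0 qfact_def numeral_2_eq_2)
next
  case (Suc n)
  show ?case
  proof (cases k)
    case 0
    then show ?thesis by (simp add: subset_gf_0 qfact_def numeral_2_eq_2)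
  next
    case (Suc j)
    have choose: "Suc j choose 2 = j + (j choose 2)"
      by (simp add: numeral_2_eq_2)
    have "j \<le> n" using Suc.prems Suc by simp
    have B: "subset_gf q n j * qfact q j * qfact q (n - j) = q ^ (j choose 2) * qfact q n"
      by (rule Suc.IH) fact
    have A: "subset_gf q n (Suc j) * qfact q (Suc j) * qfact q (n - j)
               = q ^ (j choose 2) * qfact q n * (q ^ j - q ^ n)"
    proof (cases "j = n")
      case True
      then show ?thesis by (simp add: subset_gf_gt)
    next
      case False
      then have "n - j = Suc (n - Suc j)" "Suc j \<le> n" using \<open>j \<le> n\<close> by simp_all
      then have "subset_gf q n (Suc j) * qfact q (Suc j) * qfact q (n - j)
          = (subset_gf q n (Suc j) * qfact q (Suc j) * qfact q (n - Suc j)) * (1 - q ^ (n - j))"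
        by (simp add: qfact_def mult_ac)
      also have "\<dots> = q ^ (Suc j choose 2) * qfact q n * (1 - q ^ (n - j))"
        using Suc.IH[OF \<open>Suc j \<le> n\<close>] by simp
      also have "\<dots> = q ^ (j choose 2) * qfact q n * (q ^ j * (1 - q ^ (n - j)))"
        by (simp only: choose power_add mult_ac)
      also have "q ^ j * (1 - q ^ (n - j)) = q ^ j - q ^ n"
        using \<open>j \<le> n\<close> by (simp add: right_diff_distrib flip: power_add)
      finally show ?thesis .
    qed
    have "subset_gf q (Suc n) k * qfact q k * qfact q (Suc n - k)
        = subset_gf q n (Suc j) * qfact q (Suc j) * qfact q (n - j)
          + q ^ n * (1 - q ^ Suc j) * (subset_gf q n j * qfact q j * qfact q (n - j))"
      unfolding Suc subset_gf_Suc by (simp add: qfact_def algebra_simps)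
    also have "\<dots> = q ^ (j choose 2) * qfact q n * (q ^ j - q ^ j * q ^ Suc n)"
      unfolding A B by (simp add: algebra_simps)
    also have "\<dots> = q ^ (Suc j choose 2) * qfact q (Suc n)"
      by (simp add: choose power_add qfact_def algebra_simps)
    finally show ?thesis unfolding Suc .
  qed
qed

definition box :: "nat \<Rightarrow> int set" where
  "box N = {- int N..<int N}"

lemma box_Suc: "box (Suc N) = insert (- int (Suc N)) (insert (int N) (box N))"
  by (auto simp: box_def)

text \<open>
Twice the energy, and minus the charge, of the diagram in which the levels from \<open>-N\<close> to \<open>-1\<close> are
empty.
\<close>

lemma sum_box_neg:
  "(\<Sum>j\<in>box N. if j < 0 then -(2 * j + 1) else 0) = int N ^ 2"
  "(\<Sum>j\<in>box N. if j < 0 then (1::int) else 0) = int N"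
proof -
  have "(\<Sum>j\<in>box N. if j < 0 then -(2 * j + 1) else 0) = int N ^ 2
      \<and> (\<Sum>j\<in>box N. if j < 0 then (1::int) else 0) = int N"
  proof (induction N)
    case (Suc N)
    have "finite (box N)" "int N \<notin> box N" "- int (Suc N) \<notin> insert (int N) (box N)"
      by (auto simp: box_def)
    then have eq: "sum f (box (Suc N)) = f (- int (Suc N)) + (f (int N) + sum f (box N))"
      for f :: "int \<Rightarrow> int"
      unfolding box_Suc by simp
    show ?case
      unfolding eq using Suc by (auto simp: power2_eq_square algebra_simps)
  qed (simp add: box_def)
  then show "(\<Sum>j\<in>box N. if j < 0 then -(2 * j + 1) else 0) = int N ^ 2"
    "(\<Sum>j\<in>box N. if j < 0 then (1::int) else 0) = int N"
    by auto
qed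

text \<open>
Diagrams within the box correspond to subsets of \<open>{..<2 * N}\<close>, after a shift of the levels by \<open>N\<close>:
the subset consists of the occupied levels, not of the changed ones.
\<close>

definition filled :: "nat \<Rightarrow> int set \<Rightarrow> nat set" where
  "filled N S = {i. i < 2 * N \<and> occupied S (int i - int N)}"

text \<open>
Passing from changed to occupied levels adds the constant contribution of the levels from \<open>-N\<close> to
\<open>-1\<close>, which are occupied in the vacuum; the other terms come from the shift of the levels by \<open>N\<close>
and from their energies being half-odd.
\<close>

lemma filled_sums:
  assumes "S \<subseteq> box N"
  shows "int (card (filled N S)) = charge S + int N"
    and "2 * int (\<Sum>(filled N S)) + int N = energy2 S + (2 * int N - 1) * charge S + int N ^ 2"
proof -
  have fin: "finite (box N)" by (simp add: box_def)
  have bij: "bij_betw (\<lambda>i. int i - int N) (filled N S) {j \<in> box N. occupied S j}"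
    by (rule bij_betw_byWitness[where f' = "\<lambda>j. nat (j + int N)"])
       (auto simp: filled_def box_def)
  have restrict: "sum f S = (\<Sum>j\<in>box N. if j \<in> S then f j else 0)" for f :: "int \<Rightarrow> int"
    using assms fin by (simp add: sum.If_cases Int_absorb1)
  have restrict': "(\<Sum>i\<in>filled N S. f (int i - int N)) = (\<Sum>j\<in>box N. if occupied S j then f j else 0)"
    for f :: "int \<Rightarrow> int"
    using sum.reindex_bij_betw[OF bij, of f] fin by (simp add: sum.If_cases Int_def)
  have "int (card (filled N S)) - charge S
      = (\<Sum>j\<in>box N. (if occupied S j then 1 else 0)
          - (if j \<in> S then if 0 \<le> j then 1 else - 1 else 0))"
    unfolding charge_def restrict using restrict'[of "\<lambda>_. 1"] by (simp add: sum_subtractf)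
  also have "\<dots> = (\<Sum>j\<in>box N. if j < 0 then 1 else 0)"
    by (intro sum.cong) (auto simp: occupied_def)
  finally show card: "int (card (filled N S)) = charge S + int N"
    by (simp add: sum_box_neg)
  have "energy2 S - (\<Sum>i\<in>filled N S. 2 * (int i - int N) + 1)
      = (\<Sum>j\<in>box N. (if j \<in> S then \<bar>2 * j + 1\<bar> else 0) - (if occupied S j then 2 * j + 1 else 0))"
    unfolding energy2_def restrict using restrict'[of "\<lambda>j. 2 * j + 1"] by (simp add: sum_subtractf)
  also have "\<dots> = (\<Sum>j\<in>box N. if j < 0 then -(2 * j + 1) else 0)"
    by (intro sum.cong) (auto simp: occupied_def)
  also have "\<dots> = int N ^ 2"
    by (rule sum_box_neg)
  also have "(\<Sum>i\<in>filled N S. 2 * (int i - int N) + 1)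
      = 2 * int (\<Sum>(filled N S)) - (2 * int N - 1) * int (card (filled N S))"
    by (simp add: sum.distrib sum_subtractf sum_distrib_left algebra_simps)
  finally show "2 * int (\<Sum>(filled N S)) + int N = energy2 S + (2 * int N - 1) * charge S + int N ^ 2"
    unfolding card by (simp add: algebra_simps power2_eq_square)
qed

lemma bij_betw_filled:
  "bij_betw (filled N) {S. S \<subseteq> box N \<and> charge S = 0} {A. A \<subseteq> {..<2 * N} \<and> card A = N}"
proof (rule bij_betw_byWitness[where f' = "\<lambda>A. {j \<in> box N. nat (j + int N) \<in> A \<longleftrightarrow> 0 \<le> j}"])
  show "\<forall>S\<in>{S. S \<subseteq> box N \<and> charge S = 0}.
          {j \<in> box N. nat (j + int N) \<in> filled N S \<longleftrightarrow> 0 \<le> j} = S"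
    by (auto simp: filled_def occupied_def box_def subset_iff)
  have right: "filled N {j \<in> box N. nat (j + int N) \<in> A \<longleftrightarrow> 0 \<le> j} = A" if "A \<subseteq> {..<2 * N}" for A
    using that by (auto simp: filled_def occupied_def box_def)
  then show "\<forall>A\<in>{A. A \<subseteq> {..<2 * N} \<and> card A = N}.
          filled N {j \<in> box N. nat (j + int N) \<in> A \<longleftrightarrow> 0 \<le> j} = A"
    by auto
  have "charge {j \<in> box N. nat (j + int N) \<in> A \<longleftrightarrow> 0 \<le> j} = 0" if "A \<subseteq> {..<2 * N}" "card A = N" for A
    using filled_sums(1)[of "{j \<in> box N. nat (j + int N) \<in> A \<longleftrightarrow> 0 \<le> j}" N] right[OF that(1)] that(2)
    by auto
  then show "(\<lambda>A. {j \<in> box N. nat (j + int N) \<in> A \<longleftrightarrow> 0 \<le> j}) ` {A. A \<subseteq> {..<2 * N} \<and> card A = N}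
      \<subseteq> {S. S \<subseteq> box N \<and> charge S = 0}"
    by auto
  have "card (filled N S) = N" if "S \<subseteq> box N" "charge S = 0" for S
    using filled_sums(1)[OF that(1)] that(2) by simp
  then show "filled N ` {S. S \<subseteq> box N \<and> charge S = 0} \<subseteq> {A. A \<subseteq> {..<2 * N} \<and> card A = N}"
    by (auto simp: filled_def)
qed

text \<open>
The variable is squared since \<open>energy2\<close> is twice the energy.  The minimal subset \<open>{..<N}\<close>
corresponds to the vacuum, which accounts for the extra power of \<open>y\<close>.
\<close>

lemma subset_gf_box:
  "subset_gf (y ^ 2) (2 * N) N
     = y ^ (2 * (N choose 2)) * (\<Sum>S | S \<subseteq> box N \<and> charge S = 0. y ^ nat (energy2 S))"
proof -
  have "2 * (N choose 2) + N = N ^ 2"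
    by (cases N) (simp_all add: choose_two power2_eq_square algebra_simps)
  then have N: "2 * int (N choose 2) + int N = int N ^ 2"
    by (metis of_nat_add of_nat_mult of_nat_numeral of_nat_power)
  have "2 * \<Sum>(filled N S) = 2 * (N choose 2) + nat (energy2 S)" if "S \<subseteq> box N" "charge S = 0" for S
    using filled_sums(2)[OF that(1)] that(2) N energy2_nonneg[of S]
    by (simp del: of_nat_sum)
  then have "y ^ (2 * \<Sum>(filled N S)) = y ^ (2 * (N choose 2)) * y ^ nat (energy2 S)"
    if "S \<subseteq> box N" "charge S = 0" for S
    using that by (simp add: power_add)
  then show ?thesis
    unfolding subset_gf_def sum.reindex_bij_betw[OF bij_betw_filled, symmetric]
    by (simp add: sum_distrib_left power_mult[symmetric])
qed

lemma box_gf: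
  fixes y :: "'a::idom"
  assumes "y \<noteq> 0"
  shows "(\<Sum>S | S \<subseteq> box N \<and> charge S = 0. y ^ nat (energy2 S)) * qfact (y ^ 2) N * qfact (y ^ 2) N
           = qfact (y ^ 2) (2 * N)"
  using subset_gf_gaussian[of N "2 * N" "y ^ 2"] assms
  by (simp add: subset_gf_box mult.assoc power_mult[symmetric] mult_2[symmetric])

lemma tendsto_mult_fps:
  fixes f g :: "'b \<Rightarrow> 'a::ring fps"
  assumes "(f \<longlongrightarrow> a) F" "(g \<longlongrightarrow> b) F"
  shows "((\<lambda>x. f x * g x) \<longlongrightarrow> a * b) F"
proof (rule tendsto_fpsI)
  fix n
  have "eventually (\<lambda>x. \<forall>i\<in>{..n}. fps_nth (f x) i = fps_nth a i \<and> fps_nth (g x) i = fps_nth b i) F"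
    using assms unfolding tendsto_fps_iff
    by (intro eventually_ball_finite ballI eventually_conj) auto
  then show "eventually (\<lambda>x. fps_nth (f x * g x) n = fps_nth (a * b) n) F"
    by eventually_elim (simp add: fps_mult_nth)
qed

text \<open>
The generating function of the neutral diagrams, each contributing \<open>d\<close> times twice its energy to
the exponent; \<open>d = 12\<close> is the case of exponents of \<open>q\<^bsup>1/24\<^esup>\<close>.
\<close>

definition state_gf :: "nat \<Rightarrow> complex fps" where
  "state_gf d = Abs_fps (\<lambda>n. of_nat (card {S. finite S \<and> charge S = 0 \<and> int d * energy2 S = int n}))"

text \<open>
Coefficientwise the limit is attained: diagrams of bounded energy lie in a fixed box.
\<close>

lemma box_gf_tendsto:
  assumes "d > 0"
  shows "(\<lambda>N. \<Sum>S | S \<subseteq> box N \<and> charge S = 0. (fps_X ^ d) ^ nat (energy2 S)) \<longlonglongrightarrow> state_gf d"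
proof (rule tendsto_fpsI)
  fix n
  show "eventually (\<lambda>N. fps_nth (\<Sum>S | S \<subseteq> box N \<and> charge S = 0. (fps_X ^ d) ^ nat (energy2 S)) n
          = fps_nth (state_gf d) n) sequentially"
    using eventually_ge_at_top[of n]
  proof eventually_elim
    case (elim N)
    have finb: "finite (box N)" by (simp add: box_def)
    then have fin: "finite {S. S \<subseteq> box N \<and> charge S = 0}"
      by simp
    have iff: "n = d * nat (energy2 S) \<longleftrightarrow> int d * energy2 S = int n" for S
      using energy2_nonneg[of S] by (metis int_nat_eq of_nat_eq_iff of_nat_mult)
    have "S \<subseteq> box N" if "finite S" "int d * energy2 S = int n" for S
    proof
      fix k assume "k \<in> S"
      have "energy2 S \<le> int d * energy2 S"
        using assms energy2_nonneg[of S] by (simp add: mult_le_cancel_right1)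
      then show "k \<in> box N"
        using abs_le_energy2[OF that(1) \<open>k \<in> S\<close>] that(2) elim by (auto simp: box_def)
    qed
    then have "{S. (S \<subseteq> box N \<and> charge S = 0) \<and> n = d * nat (energy2 S)}
        = {S. finite S \<and> charge S = 0 \<and> int d * energy2 S = int n}"
      unfolding iff using finite_subset[OF _ finb] by auto
    then show ?case
      using fin
      by (simp add: fps_sum_nth state_gf_def power_mult[symmetric] fps_X_power_nth
          sum.If_cases Int_def)
  qed
qed

text \<open>
With \<open>y\<close> the \<open>d\<close>-th power of the variable, the identity \<open>box_gf\<close> reads
\<open>Z\<^sub>N P\<^sub>N P\<^sub>N = P\<^bsub>2N\<^esub>\<close>, where \<open>P\<^sub>N\<close> are the partial products.  In the limit \<open>Z P P = P\<close>, and \<open>P\<close> can be cancelled since its constant term is \<open>1\<close>.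
\<close>

lemma prodinf_times_state_gf:
  assumes "d > 0"
  shows "prodinf (\<lambda>n. 1 - fps_X ^ (2 * d * Suc n)) * state_gf d = (1 :: complex fps)"
proof -
  define f :: "nat \<Rightarrow> complex fps" where "f = (\<lambda>n. 1 - fps_X ^ (2 * d * Suc n))"
  have f0: "fps_nth (f n) 0 = 1" for n
    using assms by (simp add: f_def)
  have "subdegree (f k - 1) > n" if "k > n" for n k
  proof -
    have "f k - 1 = - (fps_X ^ (2 * d * Suc k))" by (simp add: f_def)
    then have "subdegree (f k - 1) = 2 * d * Suc k"
      by (simp only: subdegree_uminus subdegree_power subdegree_fps_X mult_1_right)
    moreover have "n < 2 * d * Suc k"
    proof -
      have "n < 1 * Suc k" using that by simp
      also have "\<dots> \<le> 2 * d * Suc k" using assms by (intro mult_right_mono) auto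
      finally show ?thesis .
    qed
    ultimately show ?thesis by simp
  qed
  moreover have "f n \<noteq> 0" for n using f0[of n] by auto
  ultimately obtain P where P: "(\<lambda>n. \<Prod>k\<le>n. f k) \<longlonglongrightarrow> P"
    using tendsto_prod_fps[of f "\<lambda>n. n"] by blast
  have "P \<noteq> 0"
  proof
    assume "P = 0"
    then have "eventually (\<lambda>n. fps_nth (\<Prod>k\<le>n. f k) 0 = 0) sequentially"
      using P unfolding tendsto_fps_iff by force
    moreover have "fps_nth (\<Prod>k\<le>n. f k) 0 = 1" for n
      by (induction n) (simp_all add: f0)
    ultimately show False by simp
  qed
  then have "f has_prod P"
    using P by (simp add: has_prod_def raw_has_prod_def)
  then have prodinf: "prodinf f = P"
    by (rule has_prod_unique[symmetric])
  have qfact: "(\<lambda>N. qfact ((fps_X ^ d) ^ 2) N) \<longlonglongrightarrow> P"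
  proof (rule LIMSEQ_offset[of _ 1])
    show "(\<lambda>N. qfact ((fps_X ^ d) ^ 2) (N + 1)) \<longlonglongrightarrow> P"
      using P by (simp add: qfact_def f_def power_mult[symmetric] lessThan_Suc_atMost mult_ac
          flip: power_Suc)
  qed
  have nz: "(fps_X ^ d :: complex fps) \<noteq> 0" by simp
  have "(\<lambda>N. qfact ((fps_X ^ d) ^ 2) (2 * N)) \<longlonglongrightarrow> P"
    using LIMSEQ_subseq_LIMSEQ[OF qfact, of "\<lambda>N. 2 * N"] by (simp add: strict_mono_def o_def)
  moreover have "(\<lambda>N. qfact ((fps_X ^ d) ^ 2) (2 * N)) \<longlonglongrightarrow> state_gf d * P * P"
    unfolding box_gf[OF nz, symmetric]
    by (intro tendsto_mult_fps box_gf_tendsto qfact assms)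
  ultimately have "state_gf d * P * P = P"
    using LIMSEQ_unique by blast
  with \<open>P \<noteq> 0\<close> have "P * state_gf d = 1" by (simp add: mult.commute)
  with prodinf show ?thesis by (simp add: f_def)
qed

lemma qpow_eq: "24 * r = of_int n \<Longrightarrow> qpow r = fls_X_intpow n"
  by (simp only: qpow_def floor_of_int)

text \<open>
The rounding in \<open>qpow\<close> is harmless as soon as one of the exponents lies in \<open>(1/24) \<int>\<close>.
\<close>

lemma qpow_add: "24 * r \<in> \<int> \<Longrightarrow> qpow (r + s) = qpow r * qpow s"
  by (auto elim!: Ints_cases simp: qpow_def ring_distribs fls_X_intpow_times_fls_X_intpow)

lemma fls_nth_X_intpow_times:
  "fls_nth (fls_X_intpow n * f) j = fls_nth (f :: 'a::semiring_1 fls) (j - n)"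
  unfolding fls_X_intpow_times_conv_shift by simp

text \<open>
The graded dimension of the neutral subspace, including the shift of \<open>L(0)\<close> by \<open>1/24\<close>.
\<close>

definition neutral_gf :: qseries where
  "neutral_gf = qpow (- 1/24) * fps_to_fls (state_gf 12)"

lemma neutral_gf_nth: "fls_nth neutral_gf j = of_nat (card (neutral_level j))"
proof -
  have "neutral_level j = {S. finite S \<and> charge S = 0 \<and> int 12 * energy2 S = int (nat (j + 1))}"
    if "\<not> j < -1"
    using that by (auto simp: neutral_level_def)
  moreover have "qpow (- 1/24) = fls_X_intpow (- 1)" by (rule qpow_eq) simp
  then have "fls_nth neutral_gf j = fls_nth (fps_to_fls (state_gf 12)) (j + 1)"
    unfolding neutral_gf_def by (simp only: fls_nth_X_intpow_times diff_minus_eq_add)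
  ultimately show ?thesis
    by (auto simp: state_gf_def neutral_level_neg)
qed

lemma eta_neutral_gf: "eta * neutral_gf = 1"
proof -
  have "eta * neutral_gf = (qpow (1/24) * qpow (- 1/24))
      * fps_to_fls (prodinf (\<lambda>n. 1 - fps_X ^ (24 * Suc n)) * state_gf 12)"
    by (simp only: eta_def neutral_gf_def fls_times_fps_to_fls mult_ac)
  also have "prodinf (\<lambda>n. 1 - fps_X ^ (24 * Suc n)) * state_gf 12 = 1"
    using prodinf_times_state_gf[of 12] by simp
  also have "qpow (1/24) * qpow (- 1/24) = 1"
    by (subst qpow_add[symmetric]) (simp_all add: qpow_def)
  finally show ?thesis by simp
qed

section \<open>Traces in terms of eigenbases\<close>

context vector_space
begin

text \<open>
Reading off the coordinate at an eigenvector \<open>c\<close> of a basis of eigenvectors turns \<open>D\<close> into the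
multiplication by the eigenvalue of \<open>c\<close>; hence a vector of another eigenvalue has coordinate \<open>0\<close>.
\<close>

lemma representation_eigenvector_eq_0:
  assumes C: "independent C" "\<And>c. c \<in> C \<Longrightarrow> \<exists>a. D c = scale a c"
    and D: "Vector_Spaces.linear scale scale D"
    and v: "v \<in> span C" "D v = scale \<mu> v"
    and c: "c \<in> C" "D c \<noteq> scale \<mu> c"
  shows "representation C v c = 0"
proof -
  interpret D: Vector_Spaces.linear scale scale D by fact
  obtain \<nu> where \<nu>: "D c = scale \<nu> c" using C(2) c(1) by blast
  have "u \<in> span C \<and> D u \<in> span C \<and> representation C (D u) c = \<nu> * representation C u c"
    if "u \<in> span C" for u
    using that
  proof (induction rule: span_induct_alt)
    case base
    then show ?case by (simp add: span_zero representation_zero)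
  next
    case (step a x y)
    obtain l where l: "D x = scale l x" using C(2) step by blast
    have x: "x \<in> span C" using step by (simp add: span_base)
    moreover have "c \<noteq> 0" using c(1) C(1) dependent_zero by auto
    ultimately have "l * representation C x c = \<nu> * representation C x c"
      using \<nu> l by (auto simp: representation_basis C step c)
    then show ?case
      using x step l
      by (simp add: D.add D.scale span_add span_scale representation_add representation_scale C
          algebra_simps)
  qed
  from this[OF v(1)] have "\<mu> * representation C v c = \<nu> * representation C v c"
    using v by (simp add: representation_scale C)
  moreover have "\<mu> \<noteq> \<nu>" using c \<nu> by auto
  ultimately show ?thesis by simp
qed

text \<open>
The usual proof that the trace is invariant under a change of basis, restricted to one eigenspace.
The operator \<open>T\<close> may mix the eigenspaces; the components of \<open>T b\<close> outside the eigenspace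
drop out because the mixed coordinates vanish by the previous lemma.
\<close>

lemma trace_on_eigenspace_indep:
  assumes B: "independent B" "\<And>b. b \<in> B \<Longrightarrow> \<exists>a. D b = scale a b"
    and C: "independent C" "\<And>c. c \<in> C \<Longrightarrow> \<exists>a. D c = scale a c"
    and span: "span B = span C"
    and D: "Vector_Spaces.linear scale scale D"
    and T: "Vector_Spaces.linear scale scale T" "\<And>v. v \<in> span C \<Longrightarrow> T v \<in> span C"
    and fin: "finite {c \<in> C. D c = scale \<kappa> c}"
  shows "(\<Sum>b\<in>{b \<in> B. D b = scale \<kappa> b}. representation B (T b) b)
       = (\<Sum>c\<in>{c \<in> C. D c = scale \<kappa> c}. representation C (T c) c)"
proof -
  interpret T: Vector_Spaces.linear scale scale T by fact
  define B' C' where "B' = {b \<in> B. D b = scale \<kappa> b}" and "C' = {c \<in> C. D c = scale \<kappa> c}"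
  have B_C: "b \<in> span C" if "b \<in> B" for b using that span span_base by blast
  have T_C: "T c \<in> span B" if "c \<in> C" for c using that T(2) span span_base by blast
  \<comment> \<open>One half of the change of basis: only eigenvectors of the same eigenvalue occur.\<close>
  have b_eq: "b = (\<Sum>c\<in>C'. scale (representation C b c) c)" if b: "b \<in> B'" for b
  proof -
    have "(\<Sum>c | representation C b c \<noteq> 0. scale (representation C b c) c)
        = (\<Sum>c\<in>C'. scale (representation C b c) c)"
    proof (rule sum.mono_neutral_left)
      show "{c. representation C b c \<noteq> 0} \<subseteq> C'"
        using representation_ne_zero representation_eigenvector_eq_0[OF C D] b B_C
        by (fastforce simp: B'_def C'_def)
    qed (use fin in \<open>auto simp: C'_def\<close>)
    then show ?thesis
      using sum_nonzero_representation_eq[OF C(1)] b B_C by (simp add: B'_def)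
  qed
  have "B' \<subseteq> span C'"
  proof
    fix b assume "b \<in> B'"
    then have "b = (\<Sum>c\<in>C'. scale (representation C b c) c)" by (rule b_eq)
    also have "\<dots> \<in> span C'" by (intro span_sum span_scale span_base)
    finally show "b \<in> span C'" .
  qed
  moreover have "independent B'"
    using B(1) by (rule independent_mono) (auto simp: B'_def)
  ultimately have finB': "finite B'"
    using independent_span_bound[of C' B'] fin by (simp add: C'_def)
  \<comment> \<open>The other half: coordinates in the eigenspace depend only on coordinates in the eigenspace.\<close>
  have swap: "(\<Sum>b\<in>B'. representation B u b * representation C b c) = representation C u c"
    if u: "u \<in> span B" and c: "c \<in> C'" for u c
  proof -
    let ?F = "{b. representation B u b \<noteq> 0}"
    have F: "?F \<subseteq> B" using representation_ne_zero by blast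
    have "representation C u c = representation C (\<Sum>b\<in>?F. scale (representation B u b) b) c"
      using sum_nonzero_representation_eq[OF B(1) u] by simp
    also have "\<dots> = (\<Sum>b\<in>?F. representation B u b * representation C b c)"
      using F B_C by (subst representation_sum)
        (auto simp: C representation_scale span_scale subset_iff intro!: sum.cong)
    also have "\<dots> = (\<Sum>b\<in>B'. representation B u b * representation C b c)"
    proof (rule sum.mono_neutral_cong)
      fix b assume "b \<in> ?F - B'"
      then have b: "b \<in> B" "D b \<noteq> scale \<kappa> b" using F by (auto simp: B'_def)
      obtain a where a: "D b = scale a b" using B(2) b by blast
      have "c \<noteq> 0" using c C(1) dependent_zero by (auto simp: C'_def)
      then have "D c \<noteq> scale a c" using a b c by (auto simp: C'_def)
      then have "representation C b c = 0"
        using representation_eigenvector_eq_0[OF C D B_C[OF b(1)] a] c by (simp add: C'_def)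
      then show "representation B u b * representation C b c = 0" by simp
    qed (use finB' finite_representation in auto)
    finally show ?thesis ..
  qed
  have "representation B (T b) b = (\<Sum>c\<in>C'. representation C b c * representation B (T c) b)"
    if b: "b \<in> B'" for b
  proof -
    have "T b = (\<Sum>c\<in>C'. scale (representation C b c) (T c))"
      by (subst b_eq[OF b]) (simp add: T.sum T.scale)
    then have "representation B (T b) b
        = (\<Sum>c\<in>C'. representation B (scale (representation C b c) (T c)) b)"
      using T_C by (simp only:) (subst representation_sum, auto simp: B C'_def span_scale)
    also have "\<dots> = (\<Sum>c\<in>C'. representation C b c * representation B (T c) b)"
      using T_C by (intro sum.cong) (auto simp: representation_scale B C'_def)
    finally show ?thesis .
  qed
  then have "(\<Sum>b\<in>B'. representation B (T b) b)
      = (\<Sum>b\<in>B'. \<Sum>c\<in>C'. representation C b c * representation B (T c) b)"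
    by simp
  also have "\<dots> = (\<Sum>c\<in>C'. \<Sum>b\<in>B'. representation B (T c) b * representation C b c)"
    by (subst sum.swap) (simp add: mult.commute)
  also have "\<dots> = (\<Sum>c\<in>C'. representation C (T c) c)"
    using swap T_C by (simp add: C'_def)
  finally show ?thesis unfolding B'_def C'_def .
qed

lemma linear_maps_into_span:
  assumes T: "Vector_Spaces.linear scale scale T"
    and "\<And>x. x \<in> A \<Longrightarrow> T x \<in> span B" and "v \<in> span A"
  shows "T v \<in> span B"
proof -
  interpret T: Vector_Spaces.linear scale scale T by fact
  show ?thesis
    using \<open>v \<in> span A\<close>
    by (induction rule: span_induct_alt)
       (auto simp: T.zero T.add T.scale span_zero intro!: span_add span_scale assms)
qed

end

section \<open>The basis of Maya diagrams of the Fock space\<close>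

lemma level_in_half_odd [simp]:
  "of_int k + 1/2 \<in> half_odd" "- of_int k - 1/2 \<in> half_odd"
proof -
  show "of_int k + 1/2 \<in> half_odd" unfolding half_odd_def by blast
  have "- of_int k - 1/2 = (of_int (- k - 1) + 1/2 :: rat)" by simp
  then show "- of_int k - 1/2 \<in> half_odd" unfolding half_odd_def by blast
qed

lemma half_oddE:
  assumes "n \<in> half_odd"
  obtains k where "n = of_int k + 1/2"
  using assms by (auto simp: half_odd_def)

text \<open>
For the modes of \<open>\<psi>\<close>, which fill the level \<open>k\<close> when the mode is \<open>-k-1/2\<close>.
\<close>

lemma half_oddE':
  assumes "n \<in> half_odd"
  obtains k where "n = - of_int k - 1/2"
proof -
  obtain k where "n = of_int k + 1/2" using assms by (rule half_oddE)
  then have "n = - of_int (- k - 1) - 1/2" by simp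
  then show ?thesis by (rule that)
qed

context charged_free_fermions
begin

definition fill :: "int \<Rightarrow> 'v \<Rightarrow> 'v" where
  "fill k = \<psi> (- of_int k - 1/2)"

definition vacate :: "int \<Rightarrow> 'v \<Rightarrow> 'v" where
  "vacate k = \<psi>s (of_int k + 1/2)"

text \<open>
The operators \<open>excite k\<close> and \<open>relax k\<close> create and annihilate the change at level \<open>k\<close>: a fermion for
\<open>k \<ge> 0\<close>, a hole for \<open>k < 0\<close>.  In terms of them the vacuum is an ordinary one, annihilated by all
of the \<open>relax k\<close>.
\<close>

definition excite :: "int \<Rightarrow> 'v \<Rightarrow> 'v" where
  "excite k = (if 0 \<le> k then fill k else vacate k)"

definition relax :: "int \<Rightarrow> 'v \<Rightarrow> 'v" where
  "relax k = (if 0 \<le> k then vacate k else fill k)"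

lemma fill_linear: "Vector_Spaces.linear scale scale (fill k)"
  unfolding fill_def by (rule psi_linear) simp

lemma vacate_linear: "Vector_Spaces.linear scale scale (vacate k)"
  unfolding vacate_def by (rule psis_linear) simp

interpretation fill: Vector_Spaces.linear scale scale "fill k" for k
  by (rule fill_linear)

interpretation vacate: Vector_Spaces.linear scale scale "vacate k" for k
  by (rule vacate_linear)

interpretation excite: Vector_Spaces.linear scale scale "excite k" for k
  by (simp add: excite_def fill_linear vacate_linear)

interpretation relax: Vector_Spaces.linear scale scale "relax k" for k
  by (simp add: relax_def fill_linear vacate_linear)

lemma vacate_fill: "vacate i (fill j v) = (if i = j then v else 0) - fill j (vacate i v)"
proof -
  have "(of_int i + 1/2 + (- of_int j - 1/2) = (0::rat)) \<longleftrightarrow> i = j"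
    by auto
  then show ?thesis
    using anticomm_psi_psis[of "- of_int j - 1/2" "of_int i + 1/2" v]
    by (simp add: fill_def vacate_def eq_diff_eq add.commute)
qed

lemma fill_fill: "fill i (fill j v) = - fill j (fill i v)"
  unfolding fill_def by (rule eq_neg_iff_add_eq_0[THEN iffD2]) (rule anticomm_psi; simp)

lemma vacate_vacate: "vacate i (vacate j v) = - vacate j (vacate i v)"
  unfolding vacate_def by (rule eq_neg_iff_add_eq_0[THEN iffD2]) (rule anticomm_psis; simp)

lemma relax_excite: "relax i (excite j v) = (if i = j then v else 0) - excite j (relax i v)"
  using vacate_fill[of i j v] vacate_fill[of j i v] fill_fill[of i j v] vacate_vacate[of i j v]
  by (auto simp: relax_def excite_def)

lemma excite_excite: "excite i (excite j v) = - excite j (excite i v)"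
  using vacate_fill[of i j v] vacate_fill[of j i v] fill_fill[of i j v] vacate_vacate[of i j v]
  by (auto simp: excite_def)

text \<open>
Anticommutativity gives \<open>2 x = 0\<close>, and the scalars have characteristic \<open>0\<close>.
\<close>

lemma excite_excite_same: "excite i (excite i v) = 0"
proof -
  have "scale 2 (excite i (excite i v)) = excite i (excite i v) + excite i (excite i v)"
    using scale_left_distrib[of 1 1 "excite i (excite i v)"] by simp
  also have "\<dots> = 0" using excite_excite[of i i v] eq_neg_iff_add_eq_0 by blast
  finally show ?thesis by simp
qed

lemma relax_vac: "relax k vac = 0"
proof (cases "0 \<le> k")
  case True
  then have "(0::rat) < of_int k + 1/2" by (simp add: add_nonneg_pos)
  then show ?thesis using True by (simp add: relax_def vacate_def psis_vac)
next
  case False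
  then have "of_int k \<le> (of_int (-1) :: rat)" by (subst of_int_le_iff) simp
  then have "(0::rat) < - of_int k - 1/2" by simp
  then show ?thesis using False by (simp add: relax_def fill_def psi_vac)
qed

text \<open>
The order of the factors only fixes a sign; later statements determine the action of the
operators on these vectors up to sign, which suffices for the diagonal coefficients of products
of a \<open>\<psi>\<close> and a \<open>\<psi>*\<close>.
\<close>

definition state_vec :: "int set \<Rightarrow> 'v" where
  "state_vec S = foldr excite (sorted_list_of_set S) vac"

lemma state_vec_empty [simp]: "state_vec {} = vac"
  by (simp add: state_vec_def)

text \<open>
Moving \<open>excite i\<close> to its place in the sorted product costs a sign for each factor that it passes.
\<close>

lemma state_vec_insert:
  assumes "finite S" "i \<notin> S"
  shows "\<exists>s. (s = 1 \<or> s = -1) \<and> excite i (state_vec S) = scale s (state_vec (insert i S))"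
proof -
  have "\<exists>s. (s = 1 \<or> s = -1) \<and> excite i (foldr excite xs vac) = scale s (foldr excite (insort i xs) vac)" for xs
  proof (induction xs)
    case Nil
    show ?case by (auto intro!: exI[of _ 1])
  next
    case (Cons x xs)
    show ?case
    proof (cases "i \<le> x")
      case True
      then show ?thesis by (auto intro!: exI[of _ 1])
    next
      case False
      from Cons obtain s where s: "s = 1 \<or> s = -1"
        "excite i (foldr excite xs vac) = scale s (foldr excite (insort i xs) vac)" by blast
      have "excite i (foldr excite (x # xs) vac) = - excite x (excite i (foldr excite xs vac))"
        using excite_excite[of i x "foldr excite xs vac"] by simp
      also have "\<dots> = scale (- s) (foldr excite (insort i (x # xs)) vac)"
        using False s(2) by (simp add: excite.scale)
      finally show ?thesis using s(1) by (intro exI[of _ "- s"]) auto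
    qed
  qed
  then show ?thesis using assms by (simp add: state_vec_def)
qed

lemma relax_state_vec_notin:
  assumes "finite S" "i \<notin> S"
  shows "relax i (state_vec S) = 0"
proof -
  have "relax i (foldr excite xs vac) = 0" if "i \<notin> set xs" for xs
    using that by (induction xs) (auto simp: relax_vac relax_excite excite.zero)
  then show ?thesis using assms by (simp add: state_vec_def)
qed

lemma relax_excite_state_vec:
  assumes "finite S" "i \<notin> S"
  shows "relax i (excite i (state_vec S)) = state_vec S"
  using assms by (simp add: relax_excite relax_state_vec_notin excite.zero)

lemma state_vec_insert':
  assumes "finite S" "i \<notin> S"
  shows "\<exists>s. (s = 1 \<or> s = -1) \<and> state_vec (insert i S) = scale s (excite i (state_vec S))"
proof -
  obtain s where s: "s = 1 \<or> s = -1" "excite i (state_vec S) = scale s (state_vec (insert i S))"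
    using state_vec_insert[OF assms] by blast
  then have "scale s (excite i (state_vec S)) = state_vec (insert i S)" by auto
  with s(1) show ?thesis by metis
qed

lemma excite_state_vec_in:
  assumes "finite S" "i \<in> S"
  shows "excite i (state_vec S) = 0"
  using state_vec_insert'[of "S - {i}" i] assms
  by (auto simp: insert_absorb excite.scale excite_excite_same excite.neg)

lemma relax_state_vec_in:
  assumes "finite S" "i \<in> S"
  shows "\<exists>s. (s = 1 \<or> s = -1) \<and> relax i (state_vec S) = scale s (state_vec (S - {i}))"
  using state_vec_insert'[of "S - {i}" i] assms relax_excite_state_vec[of "S - {i}" i]
  by (auto simp: insert_absorb relax.scale relax.neg)

lemma state_vec_nonzero: "finite S \<Longrightarrow> state_vec S \<noteq> 0"
proof (induction S rule: finite_induct)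
  case empty
  show ?case by (simp add: vac_nonzero)
next
  case (insert i S)
  show ?case
  proof
    assume "state_vec (insert i S) = 0"
    then have "excite i (state_vec S) = 0" using state_vec_insert[of S i] insert by auto
    then have "state_vec S = 0" using relax_excite_state_vec[of S i] insert by (simp add: relax.zero)
    with insert show False by simp
  qed
qed

lemma fill_occupied: "finite S \<Longrightarrow> occupied S k \<Longrightarrow> fill k (state_vec S) = 0"
  using excite_state_vec_in[of S k] relax_state_vec_notin[of S k]
  by (auto simp: occupied_def excite_def relax_def split: if_splits)

lemma vacate_unoccupied: "finite S \<Longrightarrow> \<not> occupied S k \<Longrightarrow> vacate k (state_vec S) = 0"
  using excite_state_vec_in[of S k] relax_state_vec_notin[of S k]
  by (auto simp: occupied_def excite_def relax_def split: if_splits)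

lemma fill_unoccupied:
  "finite S \<Longrightarrow> \<not> occupied S k \<Longrightarrow>
    \<exists>s. (s = 1 \<or> s = -1) \<and> fill k (state_vec S) = scale s (state_vec (toggle S k))"
  using state_vec_insert[of S k] relax_state_vec_in[of S k]
  by (auto simp: occupied_def excite_def relax_def toggle_def split: if_splits)

lemma vacate_occupied:
  "finite S \<Longrightarrow> occupied S k \<Longrightarrow>
    \<exists>s. (s = 1 \<or> s = -1) \<and> vacate k (state_vec S) = scale s (state_vec (toggle S k))"
  using state_vec_insert[of S k] relax_state_vec_in[of S k]
  by (auto simp: occupied_def excite_def relax_def toggle_def split: if_splits)

text \<open>
The projection property that turns traces into numbers of diagrams.  No sign needs to be tracked:
the anticommutator of the two operators is the identity, and one of the two orders gives \<open>0\<close>.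
\<close>

lemma fill_vacate:
  assumes "finite S"
  shows "fill k (vacate k (state_vec S)) = (if occupied S k then state_vec S else 0)"
  using vacate_fill[of k k "state_vec S"] assms
  by (auto simp: fill_occupied vacate_unoccupied fill.zero vacate.zero)

lemma excite_relax_state_vec:
  assumes "finite S"
  shows "excite k (relax k (state_vec S)) = (if k \<in> S then state_vec S else 0)"
  using fill_vacate[OF assms, of k] vacate_fill[of k k "state_vec S"]
  by (auto simp: excite_def relax_def occupied_def)

text \<open>
The vectors have pairwise distinct systems of eigenvalues under the commuting projections
\<open>excite k \<circ> relax k\<close>.  A projection that tells apart two members of a vanishing combination splits it
into two shorter ones.
\<close>

lemma state_vec_combination_eq_0:
  assumes "finite F" "\<And>S. S \<in> F \<Longrightarrow> finite S" "(\<Sum>S\<in>F. scale (c S) (state_vec S)) = 0" "S \<in> F"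
  shows "c S = 0"
  using assms
proof (induction "card F" arbitrary: F rule: less_induct)
  case less
  show ?case
  proof (cases "F = {S}")
    case True
    then show ?thesis using less.prems state_vec_nonzero by auto
  next
    case False
    then obtain S' where S': "S' \<in> F" "S' \<noteq> S" using less.prems by blast
    then obtain k where k: "k \<in> S \<longleftrightarrow> k \<notin> S'" by blast
    define F1 F0 where "F1 = {R \<in> F. k \<in> R}" and "F0 = {R \<in> F. k \<notin> R}"
    have F: "F = F1 \<union> F0" "F1 \<inter> F0 = {}" "finite F1" "finite F0"
      using less.prems(1) by (auto simp: F1_def F0_def)
    have split: "(\<Sum>R\<in>F. f R) = (\<Sum>R\<in>F1. f R) + (\<Sum>R\<in>F0. f R)" for f :: "int set \<Rightarrow> 'v"
      unfolding F(1) by (rule sum.union_disjoint) (use F in auto)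
    have "0 = excite k (relax k (\<Sum>R\<in>F. scale (c R) (state_vec R)))"
      using less.prems by (simp add: relax.zero excite.zero)
    also have "\<dots> = (\<Sum>R\<in>F. scale (c R) (excite k (relax k (state_vec R))))"
      by (simp add: relax.sum excite.sum relax.scale excite.scale)
    also have "\<dots> = (\<Sum>R\<in>F1. scale (c R) (state_vec R))"
      unfolding split using less.prems(2)
      by (simp add: F1_def F0_def excite_relax_state_vec)
    finally have sum1: "(\<Sum>R\<in>F1. scale (c R) (state_vec R)) = 0" ..
    then have sum0: "(\<Sum>R\<in>F0. scale (c R) (state_vec R)) = 0"
      using less.prems(3) unfolding split by simp
    have "F1 \<subset> F" "F0 \<subset> F"
      using k S' less.prems(4) by (auto simp: F1_def F0_def)
    then have "card F1 < card F" "card F0 < card F"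
      using less.prems(1) by (auto intro: psubset_card_mono)
    moreover have "S \<in> F1 \<or> S \<in> F0" using less.prems(4) F(1) by blast
    ultimately show ?thesis
      using less.hyps[of F1] less.hyps[of F0] sum1 sum0 F(3,4) less.prems(2)
      by (auto simp: F1_def F0_def)
  qed
qed

lemma inj_on_state_vec: "inj_on state_vec (Collect finite)"
proof (rule inj_onI, rule ccontr)
  fix S S' :: "int set"
  assume S: "S \<in> Collect finite" "S' \<in> Collect finite" "state_vec S = state_vec S'" "S \<noteq> S'"
  let ?c = "\<lambda>R. if R = S then 1 else -1 :: complex"
  have "?c S = 0"
    by (rule state_vec_combination_eq_0[of "{S, S'}"]) (use S in auto)
  then show False by simp
qed

lemma independent_state_vecs: "independent (state_vec ` Collect finite)"
  unfolding independent_explicit_module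
proof (intro allI impI)
  fix t u v
  assume t: "finite t" "t \<subseteq> state_vec ` Collect finite" "(\<Sum>v\<in>t. scale (u v) v) = 0" "v \<in> t"
  then obtain F where F: "F \<subseteq> Collect finite" "finite F" "t = state_vec ` F"
    using finite_subset_image[OF t(1,2)] by auto
  then have "(\<Sum>S\<in>F. scale (u (state_vec S)) (state_vec S)) = 0"
    using t(3) inj_on_subset[OF inj_on_state_vec F(1)] by (simp add: sum.reindex)
  then show "u v = 0"
    using state_vec_combination_eq_0[of F "\<lambda>S. u (state_vec S)"] F t(4) by auto
qed

definition charged_basis :: "int \<Rightarrow> 'v set" where
  "charged_basis m = state_vec ` {S. finite S \<and> charge S = m}"

lemma fill_charge:
  assumes "v \<in> span (charged_basis m)"
  shows "fill k v \<in> span (charged_basis (m + 1))"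
proof (rule linear_maps_into_span[OF fill_linear _ assms])
  fix x assume "x \<in> charged_basis m"
  then obtain S where S: "finite S" "charge S = m" "x = state_vec S"
    by (auto simp: charged_basis_def)
  show "fill k x \<in> span (charged_basis (m + 1))"
  proof (cases "occupied S k")
    case True
    then show ?thesis using S by (simp add: fill_occupied span_zero)
  next
    case False
    then obtain s where "fill k x = scale s (state_vec (toggle S k))"
      using fill_unoccupied S by blast
    moreover have "state_vec (toggle S k) \<in> charged_basis (m + 1)"
      using S False by (auto simp: charged_basis_def charge_toggle)
    ultimately show ?thesis by (simp add: span_base span_scale)
  qed
qed

lemma vacate_charge:
  assumes "v \<in> span (charged_basis m)"
  shows "vacate k v \<in> span (charged_basis (m - 1))"
proof (rule linear_maps_into_span[OF vacate_linear _ assms])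
  fix x assume "x \<in> charged_basis m"
  then obtain S where S: "finite S" "charge S = m" "x = state_vec S"
    by (auto simp: charged_basis_def)
  show "vacate k x \<in> span (charged_basis (m - 1))"
  proof (cases "occupied S k")
    case False
    then show ?thesis using S by (simp add: vacate_unoccupied span_zero)
  next
    case True
    then obtain s where "vacate k x = scale s (state_vec (toggle S k))"
      using vacate_occupied S by blast
    moreover have "state_vec (toggle S k) \<in> charged_basis (m - 1)"
      using S True by (auto simp: charged_basis_def charge_toggle)
    ultimately show ?thesis by (simp add: span_base span_scale)
  qed
qed

lemma fermion_word_in_span:
  "fermion_word \<psi> \<psi>s vac m v \<Longrightarrow> v \<in> span (charged_basis m)"
proof (induction rule: fermion_word.induct)
  case vac
  have "vac \<in> charged_basis 0"
    unfolding charged_basis_def by (rule image_eqI[of _ _ "{}"]) (auto simp: charge_def)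
  then show ?case by (rule span_base)
next
  case (psi n m v)
  from psi(1) obtain k where "n = - of_int k - 1/2" by (rule half_oddE')
  then have "\<psi> n = fill k" by (simp add: fill_def)
  then show ?case using fill_charge psi by simp
next
  case (psis n m v)
  from psis(1) obtain k where "n = of_int k + 1/2" by (rule half_oddE)
  then have "\<psi>s n = vacate k" by (simp add: vacate_def)
  then show ?case using vacate_charge psis by simp
qed

lemma fermion_word_state_vec:
  assumes "finite S"
  shows "fermion_word \<psi> \<psi>s vac (charge S) (state_vec S)"
proof -
  have "fermion_word \<psi> \<psi>s vac (\<Sum>k\<leftarrow>xs. if 0 \<le> k then 1 else -1) (foldr excite xs vac)" for xs
  proof (induction xs)
    case Nil
    show ?case using fermion_word.vac by simp
  next
    case (Cons k xs)
    show ?case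
      using fermion_word.psi[OF _ Cons, of "- of_int k - 1/2"]
        fermion_word.psis[OF _ Cons, of "of_int k + 1/2"]
      by (simp add: excite_def fill_def vacate_def add.commute)
  qed
  from this[of "sorted_list_of_set S"] show ?thesis
    using assms by (simp add: state_vec_def charge_def sum_list_distinct_conv_sum_set)
qed

lemma charge_space_eq: "charge_space m = span (charged_basis m)"
proof
  show "charge_space m \<subseteq> span (charged_basis m)"
    unfolding charge_space_def
    by (rule span_minimal) (auto simp: fermion_word_in_span)
  show "span (charged_basis m) \<subseteq> charge_space m"
    unfolding charge_space_def charged_basis_def
    by (rule span_mono) (auto simp: fermion_word_state_vec)
qed

lemma span_state_vecs: "span (state_vec ` Collect finite) = UNIV"
proof -
  have "span (charged_basis m) \<subseteq> span (state_vec ` Collect finite)" for m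
    by (rule span_mono) (auto simp: charged_basis_def)
  then have "span {v. \<exists>m. fermion_word \<psi> \<psi>s vac m v} \<subseteq> span (state_vec ` Collect finite)"
    using fermion_word_in_span by (intro span_minimal) auto
  then show ?thesis using generated by auto
qed

subsection \<open>The operator \<open>L(0)\<close>\<close>

text \<open>
Every vector is excited at finitely many levels only, so that the sums defining \<open>L(0)\<close> are finite.
\<close>

lemma finite_excite_relax: "finite {k. excite k (relax k v) \<noteq> 0}"
proof -
  have "v \<in> span (state_vec ` Collect finite)" by (simp add: span_state_vecs)
  then show ?thesis
  proof (induction rule: span_induct_alt)
    case base
    then show ?case by (simp add: relax.zero excite.zero)
  next
    case (step c x y)
    then obtain S where S: "finite S" "x = state_vec S" by auto
    have "{k. excite k (relax k (scale c x + y)) \<noteq> 0} \<subseteq> S \<union> {k. excite k (relax k y) \<noteq> 0}"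
      using S by (auto simp: relax.add excite.add relax.scale excite.scale excite_relax_state_vec)
    then show ?case using S step by (meson finite_UnI finite_subset)
  qed
qed

text \<open>
The weighted number of excitations, an operator that is diagonal on Maya diagrams.
\<close>

definition number_sum :: "(int \<Rightarrow> complex) \<Rightarrow> 'v \<Rightarrow> 'v" where
  "number_sum c v = Sum_any (\<lambda>k. scale (c k) (excite k (relax k v)))"

lemma number_sum_linear: "Vector_Spaces.linear scale scale (number_sum c)"
proof -
  have fin: "finite {k. scale (c k) (excite k (relax k v)) \<noteq> 0}" for v
    by (rule finite_subset[OF _ finite_excite_relax[of v]]) auto
  have add: "number_sum c (u + v) = number_sum c u + number_sum c v" for u v
    unfolding number_sum_def Sum_any.distrib[OF fin fin, symmetric]
    by (simp add: relax.add excite.add scale_right_distrib)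
  have scale: "number_sum c (scale a v) = scale a (number_sum c v)" for a v
  proof -
    have "number_sum c (scale a v) = (\<Sum>k | excite k (relax k v) \<noteq> 0. scale (c k) (excite k (relax k (scale a v))))"
      unfolding number_sum_def
      by (rule Sum_any.expand_superset[OF finite_excite_relax]) (auto simp: relax.scale excite.scale)
    also have "\<dots> = scale a (\<Sum>k | excite k (relax k v) \<noteq> 0. scale (c k) (excite k (relax k v)))"
      by (simp add: relax.scale excite.scale scale_sum_right mult.commute)
    also have "(\<Sum>k | excite k (relax k v) \<noteq> 0. scale (c k) (excite k (relax k v))) = number_sum c v"
      unfolding number_sum_def
      by (rule Sum_any.expand_superset[OF finite_excite_relax, symmetric]) auto
    finally show ?thesis .
  qed
  show ?thesis
    using add scale vector_space_axioms by (simp add: Vector_Spaces.linear_iff)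
qed

lemma number_sum_state_vec:
  assumes "finite S"
  shows "number_sum c (state_vec S) = scale (\<Sum>k\<in>S. c k) (state_vec S)"
proof -
  have "number_sum c (state_vec S) = (\<Sum>k\<in>S. scale (c k) (excite k (relax k (state_vec S))))"
    unfolding number_sum_def
    by (rule Sum_any.expand_superset) (auto simp: assms excite_relax_state_vec)
  then show ?thesis using assms by (simp add: excite_relax_state_vec scale_sum_left)
qed

lemma Y_psi_eq: "Y_psi k = fill k"
  by (simp add: Y_psi_def fill_def)

lemma Y_psis_eq: "Y_psis k = vacate (- k - 1)"
  by (simp add: Y_psis_def vacate_def algebra_simps)

text \<open>
Normal ordering puts \<open>relax\<close> to the right of \<open>excite\<close>, so each term counts excitations at a level.
The weight comes from differentiating a power of \<open>x\<close>, and the term of index \<open>i\<close> concerns the level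
\<open>k = -i-2\<close>.  The sign of normal ordering switches between \<open>k = -2\<close> and \<open>k = -1\<close>, the kind of
excitation between \<open>k = -1\<close> and \<open>k = 0\<close>; this does no harm since the weight is \<open>0\<close> at \<open>k = -1\<close>.
\<close>

lemma normal_prod_psis_psi:
  "normal_prod (field_deriv Y_psis) Y_psi (- 2) v = number_sum (\<lambda>k. of_int \<bar>k + 1\<bar>) v"
  unfolding normal_prod_def number_sum_def
proof (rule Sum_any.reindex_cong)
  show "bij (\<lambda>k::int. - k - 2)"
    by (rule bij_betw_byWitness[where f' = "\<lambda>k. - k - 2"]) auto
  show "(\<lambda>i. if 0 \<le> i then field_deriv Y_psis i (Y_psi (- 2 - i) v)
          else - Y_psi (- 2 - i) (field_deriv Y_psis i v)) \<circ> (\<lambda>k. - k - 2)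
      = (\<lambda>k. scale (of_int \<bar>k + 1\<bar>) (excite k (relax k v)))"
  proof
    fix k :: int
    consider "k \<le> -2" | "k = -1" | "0 \<le> k" by linarith
    then show "((\<lambda>i. if 0 \<le> i then field_deriv Y_psis i (Y_psi (- 2 - i) v)
          else - Y_psi (- 2 - i) (field_deriv Y_psis i v)) \<circ> (\<lambda>k. - k - 2)) k
      = scale (of_int \<bar>k + 1\<bar>) (excite k (relax k v))"
      by cases (auto simp: field_deriv_def Y_psi_eq Y_psis_eq excite_def relax_def fill.scale fill.zero
          simp flip: scale_minus_left)
  qed
qed

text \<open>
Here the term of index \<open>i\<close> concerns the level \<open>k = i + 1\<close>, and the weight vanishes at the exceptional
level \<open>k = 0\<close>.
\<close>

lemma normal_prod_psi_psis:
  "normal_prod (field_deriv Y_psi) Y_psis (- 2) v = number_sum (\<lambda>k. of_int \<bar>k\<bar>) v"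
  unfolding normal_prod_def number_sum_def
proof (rule Sum_any.reindex_cong)
  show "bij (\<lambda>k::int. k - 1)"
    by (rule bij_betw_byWitness[where f' = "\<lambda>k. k + 1"]) auto
  show "(\<lambda>i. if 0 \<le> i then field_deriv Y_psi i (Y_psis (- 2 - i) v)
          else - Y_psis (- 2 - i) (field_deriv Y_psi i v)) \<circ> (\<lambda>k. k - 1)
      = (\<lambda>k. scale (of_int \<bar>k\<bar>) (excite k (relax k v)))"
  proof
    fix k :: int
    consider "k < 0" | "k = 0" | "0 < k" by linarith
    then show "((\<lambda>i. if 0 \<le> i then field_deriv Y_psi i (Y_psis (- 2 - i) v)
          else - Y_psis (- 2 - i) (field_deriv Y_psi i v)) \<circ> (\<lambda>k. k - 1)) k
      = scale (of_int \<bar>k\<bar>) (excite k (relax k v))"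
      by cases (auto simp: field_deriv_def Y_psi_eq Y_psis_eq excite_def relax_def vacate.scale vacate.zero
          simp flip: scale_minus_left)
  qed
qed

lemma Lbar0_eq:
  "Lbar0 v = scale (1/2) (number_sum (\<lambda>k. of_int \<bar>k + 1\<bar>) v)
           + scale (1/2) (number_sum (\<lambda>k. of_int \<bar>k\<bar>) v) - scale (1/24) v"
  by (simp add: Lbar0_def L_def Y_omega_def normal_prod_psis_psi normal_prod_psi_psis)

lemma Lbar0_linear: "Vector_Spaces.linear scale scale Lbar0"
proof -
  interpret n: Vector_Spaces.linear scale scale "number_sum c" for c by (rule number_sum_linear)
  show ?thesis
    using vector_space_axioms
    by (simp add: Vector_Spaces.linear_iff Lbar0_eq n.add n.scale scale_right_distrib
        scale_right_diff_distrib scale_left_commute mult.commute)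
qed

text \<open>
The two normally ordered products weigh an excitation at level \<open>k\<close> by \<open>\<bar>k + 1\<bar>\<close> and \<open>\<bar>k\<bar>\<close>, which
average to its energy \<open>\<bar>k + 1/2\<bar>\<close>.
\<close>

lemma Lbar0_state_vec:
  assumes "finite S"
  shows "Lbar0 (state_vec S) = scale (of_int (12 * energy2 S - 1) / 24) (state_vec S)"
proof -
  have "energy2 S = (\<Sum>k\<in>S. \<bar>k + 1\<bar>) + (\<Sum>k\<in>S. \<bar>k\<bar>)"
    unfolding energy2_def sum.distrib[symmetric] by (intro sum.cong) auto
  then have e: "of_int (energy2 S) = (\<Sum>k\<in>S. of_int \<bar>k + 1\<bar>) + (\<Sum>k\<in>S. of_int \<bar>k\<bar> :: complex)"
    by simp
  have "of_int (12 * energy2 S - 1) / 24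
      = 1/2 * (\<Sum>k\<in>S. of_int \<bar>k + 1\<bar>) + 1/2 * (\<Sum>k\<in>S. of_int \<bar>k\<bar>) - (1/24 :: complex)"
    by (simp add: e field_simps)
  then show ?thesis
    using assms
    by (simp only: Lbar0_eq number_sum_state_vec scale_left_distrib scale_left_diff_distrib
        scale_scale)
qed

subsection \<open>The traces\<close>

lemma independent_charged_basis: "independent (charged_basis m)"
  using independent_state_vecs by (rule independent_mono) (auto simp: charged_basis_def)

lemma eigenbasis_charged_basis: "eigenbasis (charge_space m) Lbar0 (charged_basis m)"
proof -
  have "\<forall>b\<in>charged_basis m. \<exists>c. Lbar0 b = scale c b"
    unfolding charged_basis_def using Lbar0_state_vec by blast
  then show ?thesis
    by (simp add: eigenbasis_def charge_space_eq independent_charged_basis)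
qed

lemma Lbar0_eigenvalue_iff:
  assumes "finite S"
  shows "Lbar0 (state_vec S) = scale (of_int j / 24) (state_vec S) \<longleftrightarrow> 12 * energy2 S - 1 = j"
proof -
  have "Lbar0 (state_vec S) = scale (of_int j / 24) (state_vec S)
      \<longleftrightarrow> (of_int (12 * energy2 S - 1) / 24 :: complex) = of_int j / 24"
    unfolding Lbar0_state_vec[OF assms] using state_vec_nonzero[OF assms] by (simp only: scale_cancel_right) simp
  also have "\<dots> \<longleftrightarrow> of_int (12 * energy2 S - 1) = (of_int j :: complex)"
    by (simp only: divide_cancel_right) simp
  also have "\<dots> \<longleftrightarrow> 12 * energy2 S - 1 = j"
    by (rule of_int_eq_iff)
  finally show ?thesis .
qed

text \<open>
The unknown basis chosen in the definition of the trace is replaced by the Maya diagrams.  On them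
the eigenvalues are at least \<open>-1/24\<close>, so that the coefficients do form a Laurent series.
\<close>

lemma trace_q_nth:
  assumes T: "Vector_Spaces.linear scale scale T"
    and pres: "\<And>v. v \<in> charge_space 0 \<Longrightarrow> T v \<in> charge_space 0"
  shows "fls_nth (trace_q (charge_space 0) T Lbar0) j
       = (\<Sum>S\<in>neutral_level j. representation (charged_basis 0) (T (state_vec S)) (state_vec S))"
proof -
  let ?C = "charged_basis 0"
  define B where "B = (SOME B. eigenbasis (charge_space 0) Lbar0 B)"
  have "eigenbasis (charge_space 0) Lbar0 B"
    unfolding B_def using eigenbasis_charged_basis by (rule someI)
  then have B: "independent B" "span B = span ?C" "\<And>b. b \<in> B \<Longrightarrow> \<exists>c. Lbar0 b = scale c b"
    by (auto simp: eigenbasis_def charge_space_eq)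
  have C: "independent ?C" "\<And>c. c \<in> ?C \<Longrightarrow> \<exists>a. Lbar0 c = scale a c"
    using eigenbasis_charged_basis[of 0] by (auto simp: eigenbasis_def)
  have C_level: "{c \<in> ?C. Lbar0 c = scale (of_int k / 24) c} = state_vec ` neutral_level k" for k
    unfolding charged_basis_def neutral_level_def using Lbar0_eigenvalue_iff by blast
  have inj: "inj_on state_vec (neutral_level k)" for k
    by (rule inj_on_subset[OF inj_on_state_vec]) (auto simp: neutral_level_def)
  have coeff: "(\<Sum>b\<in>{b \<in> B. Lbar0 b = scale (of_int k / 24) b}. representation B (T b) b)
      = (\<Sum>S\<in>neutral_level k. representation ?C (T (state_vec S)) (state_vec S))" for k
  proof -
    have "finite {c \<in> ?C. Lbar0 c = scale (of_int k / 24) c}"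
      unfolding C_level using finite_neutral_level by simp
    from trace_on_eigenspace_indep[OF B(1,3) C B(2) Lbar0_linear T _ this]
    show ?thesis
      using pres unfolding charge_space_eq C_level sum.reindex[OF inj] o_def by simp
  qed
  show ?thesis
    unfolding trace_q_def Let_def B_def[symmetric] coeff
    by (rule nth_Abs_fls_lower_bound[of "-1"]) (simp add: neutral_level_neg)
qed

lemma trace_q_diagonal:
  assumes "Vector_Spaces.linear scale scale T"
    and "\<And>v. v \<in> charge_space 0 \<Longrightarrow> T v \<in> charge_space 0"
    and "\<And>S. finite S \<Longrightarrow> charge S = 0 \<Longrightarrow> T (state_vec S) = (if P S then state_vec S else 0)"
  shows "fls_nth (trace_q (charge_space 0) T Lbar0) j = of_nat (card {S \<in> neutral_level j. P S})"
proof -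
  have "fls_nth (trace_q (charge_space 0) T Lbar0) j = (\<Sum>S\<in>neutral_level j. if P S then 1 else 0)"
  proof (subst trace_q_nth, fact assms(1), fact assms(2), rule sum.cong)
    fix S assume "S \<in> neutral_level j"
    then have S: "finite S" "charge S = 0" by (auto simp: neutral_level_def)
    then have "state_vec S \<in> charged_basis 0" by (auto simp: charged_basis_def)
    then show "representation (charged_basis 0) (T (state_vec S)) (state_vec S) = (if P S then 1 else 0)"
      using S by (simp add: assms(3) representation_basis independent_charged_basis representation_zero)
  qed simp
  then show ?thesis
    using finite_neutral_level by (simp add: sum.If_cases Int_def)
qed

lemma fill_vacate_linear: "Vector_Spaces.linear scale scale (\<lambda>v. fill k (vacate l v))"
  using vector_space_axioms
  by (simp add: Vector_Spaces.linear_iff fill.add fill.scale vacate.add vacate.scale)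

lemma fill_vacate_charge_space:
  "v \<in> charge_space 0 \<Longrightarrow> fill k (vacate l v) \<in> charge_space 0"
  unfolding charge_space_eq using fill_charge[of "vacate l v" "- 1" k] vacate_charge[of v 0 l] by simp

lemma trace_occupation_nth:
  "fls_nth (trace_q (charge_space 0) (\<lambda>v. fill k (vacate k v)) Lbar0) j
     = of_nat (card {S \<in> neutral_level j. occupied S k})"
  by (rule trace_q_diagonal)
     (simp_all add: fill_vacate_linear fill_vacate_charge_space fill_vacate)

text \<open>
These are the coefficients with a nonzero power of \<open>x\<close>: a fermion is moved from level \<open>l\<close> to
level \<open>k\<close>, so no diagram is mapped to a multiple of itself.
\<close>

lemma trace_hop_eq_0:
  assumes "k \<noteq> l"
  shows "trace_q (charge_space 0) (\<lambda>v. fill k (vacate l v)) Lbar0 = 0"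
proof (rule fls_eqI)
  fix j
  have "representation (charged_basis 0) (fill k (vacate l (state_vec S))) (state_vec S) = 0"
    if S: "finite S" "charge S = 0" for S
  proof (cases "occupied S l \<and> \<not> occupied (toggle S l) k")
    case True
    define S' where "S' = toggle (toggle S l) k"
    obtain s t where s: "vacate l (state_vec S) = scale s (state_vec (toggle S l))"
        "fill k (state_vec (toggle S l)) = scale t (state_vec S')"
      using True S vacate_occupied[of S l] fill_unoccupied[of "toggle S l" k] by (auto simp: S'_def)
    have S': "finite S'" "charge S' = 0"
      using True S by (simp_all add: S'_def charge_toggle)
    have "k \<in> S' \<longleftrightarrow> k \<notin> S" using assms by (simp add: S'_def in_toggle)
    then have "S' \<noteq> S" by auto
    then have "state_vec S' \<noteq> state_vec S"
      using inj_onD[OF inj_on_state_vec] S S' by blast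
    moreover have "state_vec S' \<in> charged_basis 0" using S' by (auto simp: charged_basis_def)
    ultimately have "representation (charged_basis 0) (state_vec S') (state_vec S) = 0"
      by (simp add: representation_basis independent_charged_basis)
    then show ?thesis
      using \<open>state_vec S' \<in> charged_basis 0\<close> s
      by (simp add: fill.scale representation_scale independent_charged_basis span_base)
  next
    case False
    then have "fill k (vacate l (state_vec S)) = 0"
      using S vacate_occupied[of S l] fill_occupied[of "toggle S l" k] vacate_unoccupied[of S l]
      by (cases "occupied S l") (auto simp: fill.scale fill.zero fill.neg)
    then show ?thesis by (simp add: representation_zero)
  qed
  then show "fls_nth (trace_q (charge_space 0) (\<lambda>v. fill k (vacate l v)) Lbar0) j = fls_nth 0 j"
    by (subst trace_q_nth) (simp_all add: fill_vacate_linear fill_vacate_charge_space neutral_level_def)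
qed

lemma trace_zero: "trace_q (charge_space 0) (\<lambda>_. 0) Lbar0 = 0"
proof (rule fls_eqI)
  fix j
  have "Vector_Spaces.linear scale scale (\<lambda>_. 0)"
    using vector_space_axioms by (simp add: Vector_Spaces.linear_iff)
  then show "fls_nth (trace_q (charge_space 0) (\<lambda>_. 0) Lbar0) j = fls_nth 0 j"
    using trace_q_diagonal[of "\<lambda>_. 0" "\<lambda>_. False" j] by (simp add: charge_space_eq span_zero)
qed

text \<open>
The substitutions \<open>t x\<close> and \<open>x\<close> leave one term of the product: all of the \<open>t\<close>-exponent stems from the
first factor, which then has the same \<open>x\<close>-exponent.
\<close>

lemma op_mult_X: "op_mult (at_tx X_psi) (at_x X_psis) a b = (\<lambda>v. X_psi a (X_psis (b - a) v))"
proof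
  fix v
  have zero: "X_psi c 0 = 0" for c
  proof (cases "c \<in> half_odd")
    case True
    then obtain k where "c = of_int k + 1/2" by (rule half_oddE)
    then have "X_psi c = fill k" using True by (simp add: X_psi_def fill_def)
    then show ?thesis by (simp add: fill.zero)
  qed (simp add: X_psi_def)
  have "op_mult (at_tx X_psi) (at_x X_psis) a b v
      = (\<Sum>(c, d)\<in>{(a, a)}. at_tx X_psi c d (at_x X_psis (a - c) (b - d) v))"
    unfolding op_mult_def
    by (rule Sum_any.expand_superset) (auto simp: at_tx_def at_x_def zero split: if_splits)
  then show "op_mult (at_tx X_psi) (at_x X_psis) a b v = X_psi a (X_psis (b - a) v)"
    by (simp add: at_tx_def at_x_def)
qed

lemma G_level:
  "G (of_int k + 1/2) 0 = eta * trace_q (charge_space 0) (\<lambda>v. fill k (vacate k v)) Lbar0"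
proof -
  have "- (of_int k + 1/2 :: rat) \<in> half_odd"
    using level_in_half_odd(2)[of k] by simp
  then show ?thesis
    by (simp add: G_def op_mult_X X_psi_def X_psis_def fill_def vacate_def add.commute)
qed

lemma G_eq_0:
  assumes "\<not> (a \<in> half_odd \<and> b = 0)"
  shows "G a b = 0"
proof (cases "a \<in> half_odd \<and> b - a \<in> half_odd")
  case False
  have "op_mult (at_tx X_psi) (at_x X_psis) a b = (\<lambda>_. 0)"
  proof (cases "a \<in> half_odd")
    case True
    then obtain k where "a = of_int k + 1/2" by (rule half_oddE)
    then have "X_psi a = fill k" using True by (simp add: X_psi_def fill_def)
    moreover have "X_psis (b - a) = (\<lambda>_. 0)" using True False by (simp add: X_psis_def)
    ultimately show ?thesis by (simp add: op_mult_X fill.zero)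
  qed (simp add: op_mult_X X_psi_def)
  then show ?thesis by (simp add: G_def trace_zero)
next
  case True
  then obtain k where k: "a = of_int k + 1/2" using half_oddE by blast
  from True obtain l where "b - a = - of_int l - 1/2" using half_oddE' by blast
  then have l: "- (b - a) = of_int l + 1/2" by (simp add: algebra_simps)
  have "k \<noteq> l" using assms True k l by auto
  moreover have "X_psi a = fill k" "X_psis (b - a) = vacate l"
    using True k unfolding X_psi_def X_psis_def l by (simp_all add: fill_def vacate_def)
  ultimately show ?thesis by (simp add: G_def op_mult_X trace_hop_eq_0)
qed

text \<open>
Split the neutral diagrams according to whether level \<open>k\<close> is occupied, and transport the unoccupied
ones to level \<open>k - 1\<close>.
\<close>

lemma trace_recursion:
  "trace_q (charge_space 0) (\<lambda>v. fill k (vacate k v)) Lbar0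
     + fls_X_intpow (- 24 * k) * trace_q (charge_space 0) (\<lambda>v. fill (k - 1) (vacate (k - 1) v)) Lbar0
   = neutral_gf"
proof (rule fls_eqI)
  fix j
  have "neutral_level j = {S \<in> neutral_level j. occupied S k} \<union> {S \<in> neutral_level j. \<not> occupied S k}"
    by auto
  then have "card (neutral_level j)
      = card {S \<in> neutral_level j. occupied S k} + card {S \<in> neutral_level j. \<not> occupied S k}"
    using finite_neutral_level by (metis (no_types, lifting) card_Un_disjoint disjoint_iff finite_Un mem_Collect_eq)
  then show "fls_nth (trace_q (charge_space 0) (\<lambda>v. fill k (vacate k v)) Lbar0
     + fls_X_intpow (- 24 * k) * trace_q (charge_space 0) (\<lambda>v. fill (k - 1) (vacate (k - 1) v)) Lbar0) j
    = fls_nth neutral_gf j"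
    by (simp only: fls_plus_nth fls_nth_X_intpow_times trace_occupation_nth neutral_gf_nth
        card_neutral_level_unoccupied) simp
qed

lemma G_relation: "subst_qt G a b + qpow (1/2) * times_t G a b = subst_qt delta_half a b"
proof (cases "a \<in> half_odd \<and> b = 0")
  case True
  then obtain k where a: "a = of_int k + 1/2" using half_oddE by blast
  have a': "a - 1 = of_int (k - 1) + 1/2" using a by simp
  define T where "T k = trace_q (charge_space 0) (\<lambda>v. fill k (vacate k v)) Lbar0" for k
  have "qpow (1/2) = qpow (a + of_int (- k))" by (simp add: a)
  also have "\<dots> = qpow a * qpow (of_int (- k))"
    by (rule qpow_add) (simp add: a distrib_left)
  also have "qpow (of_int (- k)) = fls_X_intpow (- 24 * k)"
    by (rule qpow_eq) simp
  finally have q: "qpow (1/2) = qpow a * fls_X_intpow (- 24 * k)" .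
  have "G a b = eta * T k" "G (a - 1) b = eta * T (k - 1)"
    using True unfolding a' by (simp_all only: a G_level T_def)
  then have "subst_qt G a b + qpow (1/2) * times_t G a b
      = qpow a * (eta * (T k + fls_X_intpow (- 24 * k) * T (k - 1)))"
    unfolding subst_qt_def times_t_def q by (simp only: ring_distribs mult_ac)
  also have "\<dots> = qpow a"
    unfolding T_def trace_recursion eta_neutral_gf by simp
  finally show ?thesis using True by (simp add: subst_qt_def delta_half_def)
next
  case False
  have "a - 1 \<in> half_odd \<Longrightarrow> a \<in> half_odd"
  proof (elim half_oddE)
    fix k assume "a - 1 = of_int k + 1/2"
    then have "a = of_int (k + 1) + 1/2" by simp
    then show "a \<in> half_odd" by (simp only: level_in_half_odd)
  qed
  then show ?thesis
    using False by (auto simp: subst_qt_def times_t_def delta_half_def G_eq_0)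
qed

end

theorem proposition3p3:
  fixes scale :: "complex \<Rightarrow> 'v::ab_group_add \<Rightarrow> 'v"
    and \<psi> \<psi>s :: "rat \<Rightarrow> 'v \<Rightarrow> 'v"
    and vac :: 'v
    and G :: "qseries tx_series"
  assumes "charged_free_fermions scale \<psi> \<psi>s vac"
  defines "G \<equiv> charged_free_fermions.G scale \<psi> \<psi>s vac"
  shows "(\<lambda>a b. subst_qt G a b + qpow (1/2) * times_t G a b) = subst_qt delta_half"
  unfolding G_def using charged_free_fermions.G_relation[OF assms(1)] by (intro ext)

end
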